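(* Let $\mathfrak{g}$ be the real nilpotent Lie algebra generated by the elements $X,U,V,E,Z$ (which form a basis), with non-trivial brackets $[U,V]=E$, $[X,U]=V$, $[X,V]=Z$. Let $\lambda=E^{*}\in\mathfrak{g}^{*}$, and consider the Lie subalgebra $\mathfrak{h}=\mathbb{R}X\oplus \mathbb{R}E$ of $\mathfrak{g}$. Let $l\in\lambda+\mathfrak{h}^\perp$ with $l(Z)\neq 0$, and let $\mathfrak{q}=\langle Z,V,U\rangle$ and $\mathfrak{q}_l=\langle Z,V,X-l(Z)U+l(V)V\rangle$. Then: (1) for $u\in (U(\mathfrak{g})/U(\mathfrak{g})\mathfrak{h}_{\lambda})^{\mathfrak{h}}$, $$\beta_{\mathfrak{q}_l}^{-1}(u)=e^{\left[\frac{1}{12\,l(Z)}\left(1-\frac{Z}{2\,l(Z)}\right)\partial_U^3\right]}\beta_{\mathfrak{q}}^{-1}(u);$$ (2) if $v$ is a polynomial in $(U(\mathfrak{g})/U(\mathfrak{g})\mathfrak{h}_{\lambda})^{\mathfrak{h}}$ (a polynomial expression in the generators $Z$ and $A=2UZ-V^2$), then $$\beta_{\mathfrak{q}}^{-1}(v)(l)=e^{-\frac{1}{24\,l(Z)}\partial_U^3}\beta^{-1}_{\mathfrak{q}_l}(v)(l);$$ (3) the map $$\gamma_{CT}:\ v\mapsto \left(e^{\left[\frac{1}{12\,l(Z)}\left(1-\frac{Z}{2\,l(Z)}\right)\partial_U^3\right]}\beta_{\mathfrak{q}}^{-1}(v)\right)(l)$$ is a character of $(U(\mathfrak{g})/U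(\mathfrak{g})\mathfrak{h}_{\lambda})^{\mathfrak{h}}$.
   Context: $E^*$ is the element of the dual basis with $E^*(E)=1$ and $E^*=0$ on $X,U,V,Z$. $\mathfrak{h}^\perp=\{\xi\in\mathfrak{g}^*:\xi|_{\mathfrak h}=0\}$, so $\lambda+\mathfrak{h}^\perp=\{l\in\mathfrak{g}^*:\ l(X)=0,\ l(E)=1\}$. $U(\mathfrak{g})\mathfrak{h}_\lambda$ is the left ideal of the enveloping algebra $U(\mathfrak{g})$ generated by $\{H+\lambda(H): H\in\mathfrak{h}\}$, i.e. by $X$ and $E+1$; $(U(\mathfrak{g})/U(\mathfrak{g})\mathfrak{h}_\lambda)^{\mathfrak{h}}$ is the algebra of classes of $u\in U(\mathfrak g)$ with $[H,u]\in U(\mathfrak{g})\mathfrak{h}_\lambda$ for all $H\in\mathfrak{h}$. For a complement $\mathfrak{p}$ of $\mathfrak{h}$ in $\mathfrak{g}$ (here $\mathfrak{p}=\mathfrak{q}$ or $\mathfrak{q}_l$), $\beta_{\mathfrak{p}}:S(\mathfrak{p})\to U(\mathfrak{g})/U(\mathfrak{g})\mathfrak{h}_\lambda$ is the linear bijection obtained from the symmetrization map $S(\mathfrak{g})\to U(\mathfrak{g})$ restricted to $S(\mathfrak{p})$, followed by projection. Both $S(\mathfrak{q})$ and $S(\mathfrak{q}_l)$ are identified with $\mathbb{R}[Z,V,U]$ by viewing their elements as polynomial functions on $\mathfrak{g}^*$ and setting $X=0$; for instance $X-l(Z)U+l(V)V\in\mathfrak{q}_l$ corresponds to $-l(Z)U+l(V)V$.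 Equalities between elements of $S(\mathfrak{q}_l)$ and $S(\mathfrak{q})$ are understood through this identification; $\partial_U$ is the partial derivative in the coordinates $(Z,V,U)$, $Z$ in the exponent acts by multiplication, and $P(l)$ denotes the value of the polynomial $P$ at $l$ (in (2), the exponential operator is applied first and the result is evaluated at $l$). A character is an algebra homomorphism to the base field $\mathbb{R}$.
   Formalization: The left ideal U(g)h_λ is taken to be generated by H − λ(H), i.e. by X and E − 1, instead of H + λ(H), i.e. X and E + 1; with E + 1 parts (1) and (2) fail for the class of the symmetrization of (2UZ − V²)³. *)

theory Defs
  imports "HOL-Analysis.Analysis" "HOL-Analysis.Finite_Function_Topology"
begin

section \<open>The Lie algebra\<close>

datatype gen = GX | GU | GV | GE | GZ

lemma UNIV_gen: "UNIV = {GX, GU, GV, GE, GZ}"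
  using gen.exhaust by blast

instance gen :: finite
  by standard (simp add: UNIV_gen)

type_synonym lie = "real ^ gen"

abbreviation eX :: lie where "eX \<equiv> axis GX 1"
abbreviation eU :: lie where "eU \<equiv> axis GU 1"
abbreviation eV :: lie where "eV \<equiv> axis GV 1"
abbreviation eE :: lie where "eE \<equiv> axis GE 1"
abbreviation eZ :: lie where "eZ \<equiv> axis GZ 1"

definition lbr :: "lie \<Rightarrow> lie \<Rightarrow> lie" where
  "lbr x y =
     (x $ GU * y $ GV - x $ GV * y $ GU) *\<^sub>R eE
   + (x $ GX * y $ GU - x $ GU * y $ GX) *\<^sub>R eV
   + (x $ GX * y $ GV - x $ GV * y $ GX) *\<^sub>R eZ"

lemma lbr_basis:
  "lbr eU eV = eE" "lbr eX eU = eV" "lbr eX eV = eZ"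
  "lbr eX eE = 0" "lbr eX eZ = 0" "lbr eU eE = 0" "lbr eU eZ = 0"
  "lbr eV eE = 0" "lbr eV eZ = 0" "lbr eE eZ = 0"
  by (simp_all add: lbr_def axis_def)

lemma bilinear_lbr: "bilinear lbr"
  by (auto simp: bilinear_def lbr_def algebra_simps intro!: linearI)

lemma lbr_self: "lbr x x = 0"
  by (simp add: lbr_def)

lemma lbr_Jacobi: "lbr x (lbr y z) + lbr y (lbr z x) + lbr z (lbr x y) = 0"
  by (simp add: lbr_def vec_eq_iff axis_def algebra_simps)

lemma lbr_nilpotent: "lbr x (lbr y (lbr z w)) = 0"
  by (simp add: lbr_def vec_eq_iff axis_def algebra_simps)

definition lam :: "lie \<Rightarrow> real" where
  "lam x = x $ GE"

definition hh :: "lie set" where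
  "hh = span {eX, eE}"

definition hperp :: "(lie \<Rightarrow> real) set" where
  "hperp = {\<xi>. linear \<xi> \<and> (\<forall>H\<in>hh. \<xi> H = 0)}"

definition lam_hperp :: "(lie \<Rightarrow> real) set" where
  "lam_hperp = {(\<lambda>x. lam x + \<xi> x) | \<xi>. \<xi> \<in> hperp}"

definition qq :: "lie set" where
  "qq = span {eZ, eV, eU}"

definition qql :: "(lie \<Rightarrow> real) \<Rightarrow> lie set" where
  "qql l = span {eZ, eV, eX - l eZ *\<^sub>R eU + l eV *\<^sub>R eV}"


section \<open>The enveloping algebra\<close>

text \<open>Free monoid, written additively so that \<open>'a fmon \<Rightarrow>\<^sub>0 real\<close> with its convolution product
  is the free associative unital algebra. For \<open>'a = gen\<close> this is the tensor algebra of the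
  Lie algebra.\<close>

datatype 'a fmon = FM (letters: "'a list")

instantiation fmon :: (type) monoid_add
begin
definition "0 = FM []"
definition "v + w = FM (letters v @ letters w)"
instance
  by standard (auto simp: zero_fmon_def plus_fmon_def fmon.expand)
end

lemma plus_fmon_eq_0_iff: "(v :: 'a fmon) + w = 0 \<longleftrightarrow> v = 0 \<and> w = 0"
  by (cases v; cases w) (auto simp: zero_fmon_def plus_fmon_def)

lemma lookup_scaleR: "Poly_Mapping.lookup (r *\<^sub>R p) m = r *\<^sub>R Poly_Mapping.lookup p m"
proof -
  have "finite {i. r *\<^sub>R Poly_Mapping.lookup p i \<noteq> 0}"
    by (rule finite_subset[OF _ finite_lookup[of p]]) auto
  then show ?thesis
    by (simp add: scaleR_poly_mapping_def)
qed

lemma single_add_induct [case_names zero single add]: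
  fixes p :: "'a \<Rightarrow>\<^sub>0 'b::monoid_add"
  assumes "P 0" and "\<And>k v. P (Poly_Mapping.single k v)"
    and "\<And>a b. P a \<Longrightarrow> P b \<Longrightarrow> P (a + b)"
  shows "P p"
proof (induction p rule: update_induct)
  case const
  then show ?case by (rule assms)
next
  case (update f a b)
  have "Poly_Mapping.update a b f = f + Poly_Mapping.single a b"
    using update(1)
    by (auto intro!: poly_mapping_eqI
        simp: lookup_update lookup_add lookup_single when_def in_keys_iff)
  then show ?case using update assms by simp
qed

lemma scaleR_eq_single_times:
  fixes p :: "'a::monoid_add \<Rightarrow>\<^sub>0 real"
  shows "r *\<^sub>R p = Poly_Mapping.single 0 r * p"
    and "r *\<^sub>R p = p * Poly_Mapping.single 0 r"
proof -
  have "Poly_Mapping.lookup (Poly_Mapping.single 0 r * p) m = r * Poly_Mapping.lookup p m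
      \<and> Poly_Mapping.lookup (p * Poly_Mapping.single 0 r) m = r * Poly_Mapping.lookup p m" for m
    by (induction p rule: single_add_induct)
      (simp_all add: mult_single lookup_single when_def lookup_add distrib_left distrib_right)
  then show "r *\<^sub>R p = Poly_Mapping.single 0 r * p" "r *\<^sub>R p = p * Poly_Mapping.single 0 r"
    by (auto intro!: poly_mapping_eqI simp: lookup_scaleR)
qed

lemma scaleR_mult_poly_mapping:
  fixes p q :: "'a::monoid_add \<Rightarrow>\<^sub>0 real"
  shows "(r *\<^sub>R p) * q = r *\<^sub>R (p * q)" and "p * (r *\<^sub>R q) = r *\<^sub>R (p * q)"
proof -
  show "(r *\<^sub>R p) * q = r *\<^sub>R (p * q)"
    by (simp add: scaleR_eq_single_times(1) mult.assoc)
  show "p * (r *\<^sub>R q) = r *\<^sub>R (p * q)"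
    by (simp add: scaleR_eq_single_times(2) mult.assoc)
qed

type_synonym tens = "gen fmon \<Rightarrow>\<^sub>0 real"

definition tin :: "lie \<Rightarrow> tens" where
  "tin x = (\<Sum>g\<in>UNIV. Poly_Mapping.single (FM [g]) (x $ g))"

definition uea_ideal :: "tens set" where
  "uea_ideal = span {a * (tin x * tin y - tin y * tin x - tin (lbr x y)) * b | a b x y. True}"

lemma uea_ideal_zero: "0 \<in> uea_ideal"
  by (simp add: uea_ideal_def span_zero)

lemma uea_ideal_add: "a \<in> uea_ideal \<Longrightarrow> b \<in> uea_ideal \<Longrightarrow> a + b \<in> uea_ideal"
  by (simp add: uea_ideal_def span_add)

lemma uea_ideal_neg: "a \<in> uea_ideal \<Longrightarrow> - a \<in> uea_ideal"
  by (simp add: uea_ideal_def span_neg)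

lemma uea_ideal_scaleR: "a \<in> uea_ideal \<Longrightarrow> r *\<^sub>R a \<in> uea_ideal"
  by (simp add: uea_ideal_def span_scale)

lemma uea_ideal_mult:
  assumes "a \<in> uea_ideal"
  shows "c * a \<in> uea_ideal" and "a * c \<in> uea_ideal"
proof -
  have "c * a \<in> uea_ideal \<and> a * c \<in> uea_ideal"
    using assms unfolding uea_ideal_def
  proof (induction rule: span_induct_alt)
    case base
    then show ?case by (simp add: span_zero)
  next
    case (step r x y)
    then obtain a b u v where
      x: "x = a * (tin u * tin v - tin v * tin u - tin (lbr u v)) * b" by blast
    have "c * x = (c * a) * (tin u * tin v - tin v * tin u - tin (lbr u v)) * b"
      "x * c = a * (tin u * tin v - tin v * tin u - tin (lbr u v)) * (b * c)"
      by (simp_all add: x mult.assoc)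
    then have "c * x \<in> span {a * (tin x * tin y - tin y * tin x - tin (lbr x y)) * b | a b x y. True}"
      "x * c \<in> span {a * (tin x * tin y - tin y * tin x - tin (lbr x y)) * b | a b x y. True}"
      by (auto intro!: span_base)
    with step show ?case
      by (auto simp: distrib_left distrib_right scaleR_mult_poly_mapping
          intro!: span_add span_scale)
  qed
  then show "c * a \<in> uea_ideal" "a * c \<in> uea_ideal" by auto
qed

lemma lookup_times_zero:
  fixes a b :: "'a fmon \<Rightarrow>\<^sub>0 real"
  shows "Poly_Mapping.lookup (a * b) 0 = Poly_Mapping.lookup a 0 * Poly_Mapping.lookup b 0"
proof (induction a rule: single_add_induct)
  case (single k v)
  show ?case
    by (induction b rule: single_add_induct)
      (auto simp: mult_single lookup_single when_def plus_fmon_eq_0_iff lookup_add distrib_left)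
qed (simp_all add: distrib_right lookup_add)

lemma one_notin_uea_ideal: "1 \<notin> uea_ideal"
proof -
  have tin0: "Poly_Mapping.lookup (tin x) 0 = 0" for x
    by (simp add: tin_def lookup_sum lookup_single zero_fmon_def)
  have "Poly_Mapping.lookup a 0 = 0" if "a \<in> uea_ideal" for a
    using that unfolding uea_ideal_def
    by (induction rule: span_induct_alt)
      (auto simp: lookup_add lookup_minus lookup_scaleR lookup_times_zero tin0)
  then show ?thesis by (metis lookup_one_zero zero_neq_one)
qed

quotient_type uea = tens / "\<lambda>a b. a - b \<in> uea_ideal"
proof (rule equivpI)
  show "reflp (\<lambda>a b. a - b \<in> uea_ideal)"
    by (simp add: reflp_def uea_ideal_zero)
  show "symp (\<lambda>a b. a - b \<in> uea_ideal)"
    by (metis (no_types, lifting) minus_diff_eq sympI uea_ideal_neg)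
  show "transp (\<lambda>a b. a - b \<in> uea_ideal)"
    by (metis (no_types, lifting) diff_add_cancel add_diff_eq transpI uea_ideal_add)
qed

instantiation uea :: real_algebra_1
begin

lift_definition zero_uea :: uea is 0 .
lift_definition one_uea :: uea is 1 .

lift_definition plus_uea :: "uea \<Rightarrow> uea \<Rightarrow> uea" is "(+)"
  by (metis add_diff_add uea_ideal_add)

lift_definition uminus_uea :: "uea \<Rightarrow> uea" is uminus
  by (metis minus_diff_minus uea_ideal_neg)

lift_definition minus_uea :: "uea \<Rightarrow> uea \<Rightarrow> uea" is "(-)"
  by (metis (no_types, opaque_lifting) add_diff_add diff_conv_add_uminus minus_diff_minus
      uea_ideal_add uea_ideal_neg)

lift_definition times_uea :: "uea \<Rightarrow> uea \<Rightarrow> uea" is "(*)"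
proof -
  fix a b c d :: tens
  assume "a - b \<in> uea_ideal" "c - d \<in> uea_ideal"
  moreover have "a * c - b * d = (a - b) * c + b * (c - d)" by (simp add: algebra_simps)
  ultimately show "a * c - b * d \<in> uea_ideal"
    by (simp add: uea_ideal_add uea_ideal_mult)
qed

lift_definition scaleR_uea :: "real \<Rightarrow> uea \<Rightarrow> uea" is scaleR
  by (metis scaleR_diff_right uea_ideal_scaleR)

instance
proof
  show "(0 :: uea) \<noteq> 1"
    by transfer (metis diff_0 minus_minus one_notin_uea_ideal uea_ideal_neg)
qed (transfer; simp add: algebra_simps uea_ideal_zero scaleR_mult_poly_mapping)+

end

lift_definition uin :: "lie \<Rightarrow> uea" is tin .


section \<open>The quotient by the left ideal and its invariants\<close>

text \<open>Sign convention: the generators are \<open>H - \<lambda>(H)\<close>, so that in the quotient each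
  \<open>H \<in> \<h>\<close> acts by the value \<open>\<lambda>(H)\<close> that it takes on \<open>\<lambda> + \<h>\<^sup>\<bottom>\<close>; that is, the generators
  are \<open>X\<close> and \<open>E - 1\<close>. With \<open>H + \<lambda>(H)\<close> (that is, \<open>E + 1\<close>) and the same \<open>l\<close>, the exponent
  that relates the two symmetrizations would be
  \<open>- 1 / (12 l(Z)) (1 + Z / (2 l(Z))) \<partial>\<^sub>U\<^sup>3\<close>, as the class of the symmetrization of
  \<open>(2 U Z - V\<^sup>2)\<^sup>3\<close> shows.\<close>

definition hlam_ideal :: "uea set" where
  "hlam_ideal = span {a * (uin H - lam H *\<^sub>R 1) | a H. H \<in> hh}"

definition cls :: "uea \<Rightarrow> uea set" where
  "cls u = {w. w - u \<in> hlam_ideal}"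

definition hinv :: "uea set" where
  "hinv = {u. \<forall>H\<in>hh. uin H * u - u * uin H \<in> hlam_ideal}"

definition inv_alg :: "uea set set" where
  "inv_alg = cls ` hinv"

text \<open>The product of \<open>inv_alg\<close> is induced by that of \<open>uea\<close>; it is well defined on classes
  of elements of \<open>hinv\<close>, though not on the whole quotient by the left ideal.\<close>

definition is_character :: "(uea set \<Rightarrow> real) \<Rightarrow> bool" where
  "is_character \<phi> \<longleftrightarrow>
     \<phi> (cls 1) = 1 \<and>
     (\<forall>a\<in>hinv. \<forall>b\<in>hinv. \<phi> (cls (a + b)) = \<phi> (cls a) + \<phi> (cls b)) \<and>
     (\<forall>r. \<forall>a\<in>hinv. \<phi> (cls (r *\<^sub>R a)) = r * \<phi> (cls a)) \<and>
     (\<forall>a\<in>hinv. \<forall>b\<in>hinv. \<phi> (cls (a * b)) = \<phi> (cls a) * \<phi> (cls b))"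

definition uA :: uea where
  "uA = 2 * uin eU * uin eZ - uin eV ^ 2"

definition ZA_polynomials :: "uea set set" where
  "ZA_polynomials =
     {cls (\<Sum>i\<le>n. \<Sum>j\<le>n. c i j *\<^sub>R (uin eZ ^ i * uA ^ j)) | (n::nat) (c::nat \<Rightarrow> nat \<Rightarrow> real). True}"


section \<open>Symmetric algebra and symmetrization\<close>

text \<open>The symmetric algebra of the Lie algebra, as polynomials in the basis elements.\<close>

type_synonym sym = "(gen \<Rightarrow>\<^sub>0 nat) \<Rightarrow>\<^sub>0 real"

definition sin1 :: "lie \<Rightarrow> sym" where
  "sin1 x = (\<Sum>g\<in>UNIV. Poly_Mapping.single (Poly_Mapping.single g 1) (x $ g))"

definition Sym :: "lie set \<Rightarrow> sym set" where
  "Sym p = span {prod_list (map sin1 xs) | xs. set xs \<subseteq> p}"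

definition mon_letters :: "(gen \<Rightarrow>\<^sub>0 nat) \<Rightarrow> gen list" where
  "mon_letters m = concat (map (\<lambda>g. replicate (Poly_Mapping.lookup m g) g) [GX, GU, GV, GE, GZ])"

definition symm_word :: "gen list \<Rightarrow> uea" where
  "symm_word w = (1 / fact (length w)) *\<^sub>R
     (\<Sum>\<pi> | \<pi> permutes {..<length w}.
        prod_list (map (\<lambda>i. uin (axis (w ! \<pi> i) 1)) [0..<length w]))"

definition symmetrization :: "sym \<Rightarrow> uea" where
  "symmetrization P = 
     (\<Sum>m\<in>Poly_Mapping.keys P. Poly_Mapping.lookup P m *\<^sub>R symm_word (mon_letters m))"

definition beta :: "sym \<Rightarrow> uea set" where
  "beta P = cls (symmetrization P)"

definition setX0 :: "sym \<Rightarrow> sym" where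
  "setX0 P =
     (\<Sum>m | m \<in> Poly_Mapping.keys P \<and> Poly_Mapping.lookup m GX = 0.
        Poly_Mapping.single m (Poly_Mapping.lookup P m))"

text \<open>The inverse of the bijection \<open>beta\<close> on the symmetric algebra of the complement \<open>p\<close>,
  its value being identified with a polynomial in \<open>Z, V, U\<close>.\<close>

definition beta_inv :: "lie set \<Rightarrow> uea set \<Rightarrow> sym" where
  "beta_inv p C = setX0 (inv_into (Sym p) beta C)"

definition eval_at :: "(lie \<Rightarrow> real) \<Rightarrow> sym \<Rightarrow> real" where
  "eval_at l P =
     (\<Sum>m\<in>Poly_Mapping.keys P.
        Poly_Mapping.lookup P m * (\<Prod>g\<in>UNIV. l (axis g 1) ^ Poly_Mapping.lookup m g))"

definition dU :: "sym \<Rightarrow> sym" where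
  "dU P = (\<Sum>m\<in>Poly_Mapping.keys P.
     Poly_Mapping.single (m - Poly_Mapping.single GU 1)
       (real (Poly_Mapping.lookup m GU) * Poly_Mapping.lookup P m))"

text \<open>Exponential of a locally nilpotent operator: for each \<open>P\<close> only finitely many terms
  are nonzero, which is what \<open>Sum_any\<close> needs.\<close>

definition exp_op :: "(sym \<Rightarrow> sym) \<Rightarrow> sym \<Rightarrow> sym" where
  "exp_op T P = Sum_any (\<lambda>n. (1 / fact n) *\<^sub>R (T ^^ n) P)"

definition cubic_op :: "sym \<Rightarrow> sym \<Rightarrow> sym" where
  "cubic_op Q P = Q * dU (dU (dU P))"

definition ct_coeff :: "real \<Rightarrow> sym" where
  "ct_coeff c = (1 / (12 * c)) *\<^sub>R (1 - (1 / (2 * c)) *\<^sub>R sin1 eZ)"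

definition gamma_CT :: "(lie \<Rightarrow> real) \<Rightarrow> uea set \<Rightarrow> real" where
  "gamma_CT l v = eval_at l (exp_op (cubic_op (ct_coeff (l eZ))) (beta_inv qq v))"

end

theory Submission
  imports Defs
begin

text \<open>Modulo the left ideal, \<open>E\<close> acts as \<open>1\<close> and \<open>X\<close> kills the class of \<open>1\<close>, so the quotient is
a Weyl-algebra module. In the coordinates given by the symmetrization of \<open>\<langle>Z,V,U\<rangle>\<close> it is
\<open>\<real>[z,v,u]\<close>, on which the generators act by the Weyl operators
\<open>Z = z\<close>, \<open>E = 1\<close>, \<open>V = v - \<partial>\<^sub>u/2\<close>, \<open>U = u + \<partial>\<^sub>v/2\<close> and \<open>X = v\<partial>\<^sub>u + z\<partial>\<^sub>v\<close>. Hence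
the inverse of \<open>beta\<close> on \<open>qq\<close> sends the class of \<open>a\<close> to \<open>a \<cdot> 1\<close> (\<open>beta_inv_qq\<close>), and the class
of an invariant element lies in the kernel of the derivation \<open>X\<close>.

Write \<open>c = l(Z)\<close>. On the span of \<open>Z\<close>, \<open>V\<close> and \<open>Y = X - cU + l(V)V\<close> the only bracket is
\<open>[Y,V] = Z - cE\<close>, which acts as \<open>z - c\<close>. In the coordinates given by the symmetrization of
\<open>qql l\<close> an element \<open>w\<close> of that span therefore acts as multiplication by \<open>w\<close> plus \<open>(z - c)/2\<close>
times a derivation that kills \<open>w\<close> itself, and so \<open>w^n\<close> has the symbol \<open>w^n\<close>. The change of
coordinates is
\<open>Theta = exp (\<kappa>\<partial>\<^sub>u\<^sup>3 + \<partial>\<^sub>uX/(2c))\<close> with \<open>\<kappa> = (1 - z/(2c))/(12c)\<close>: this operator conjugates the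
first action into the second (\<open>Theta_weyl\<close>). On the kernel of \<open>X\<close> the term \<open>\<partial>\<^sub>uX\<close> drops out
(\<open>Theta_on_kernel_adX\<close>), which is the formula relating the two inverse symmetrizations.
Two general facts turn these computations into statements about \<open>beta\<close>. Products in
the symmetric algebra are linear combinations of powers (\<open>Sym_spanned_by_powers\<close>), so symbols
need only be computed on powers; and, by induction on the length of words, the symmetrization
of any complement of \<open>\<h>\<close> reaches every class (\<open>beta_surjective\<close>).

The last two claims come from putting \<open>z = c\<close>. There \<open>\<kappa>\<close> becomes \<open>1/(24c)\<close>, so that the
exponential of \<open>-\<partial>\<^sub>u\<^sup>3/(24c)\<close> undoes that of \<open>\<kappa>\<partial>\<^sub>u\<^sup>3\<close> at \<open>l\<close> (\<open>eval_at_exp_inverse\<close>). Moreover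
the derivation terms of the second action carry the factor \<open>z - c\<close>, so evaluation at \<open>l\<close> after
\<open>Theta\<close> is an eigenfunctional of the span of \<open>Z\<close>, \<open>V\<close> and \<open>Y\<close>, with eigenvalues given by \<open>l\<close>.
Since every class is a symmetrization over that span, and the left ideal absorbs right
multiplication by invariant elements, this functional is multiplicative on invariants
(\<open>eval_at_Theta_mult\<close>).\<close>

section \<open>Linear maps given on monomials, and derivations\<close>

definition lin_ext :: "('a \<Rightarrow> 'c::real_vector) \<Rightarrow> ('a \<Rightarrow>\<^sub>0 real) \<Rightarrow> 'c" where
  "lin_ext F P = (\<Sum>m\<in>Poly_Mapping.keys P. Poly_Mapping.lookup P m *\<^sub>R F m)"

lemma lin_ext_superset:
  assumes "finite A" "Poly_Mapping.keys P \<subseteq> A"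
  shows "lin_ext F P = (\<Sum>m\<in>A. Poly_Mapping.lookup P m *\<^sub>R F m)"
  unfolding lin_ext_def using assms
  by (intro sum.mono_neutral_left) (auto simp: in_keys_iff)

lemma linear_lin_ext: "linear (lin_ext F)"
proof (rule linearI)
  fix p q :: "'a \<Rightarrow>\<^sub>0 real" and r :: real
  let ?A = "Poly_Mapping.keys p \<union> Poly_Mapping.keys q"
  have "lin_ext F x = (\<Sum>m\<in>?A. Poly_Mapping.lookup x m *\<^sub>R F m)"
    if "Poly_Mapping.keys x \<subseteq> ?A" for x
    using that by (intro lin_ext_superset) auto
  moreover have "Poly_Mapping.keys (p + q) \<subseteq> ?A"
    by (rule Poly_Mapping.keys_add)
  ultimately show "lin_ext F (p + q) = lin_ext F p + lin_ext F q"
    by (simp add: lookup_add scaleR_left_distrib sum.distrib)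
  have "Poly_Mapping.keys (r *\<^sub>R p) \<subseteq> Poly_Mapping.keys p"
    by (auto simp: in_keys_iff lookup_scaleR)
  then have "lin_ext F (r *\<^sub>R p)
      = (\<Sum>m\<in>Poly_Mapping.keys p. Poly_Mapping.lookup (r *\<^sub>R p) m *\<^sub>R F m)"
    by (intro lin_ext_superset) auto
  then show "lin_ext F (r *\<^sub>R p) = r *\<^sub>R lin_ext F p"
    by (simp add: lin_ext_def lookup_scaleR scaleR_sum_right)
qed

lemma lin_ext_single: "lin_ext F (Poly_Mapping.single m a) = a *\<^sub>R F m"
  by (simp add: lin_ext_def)

lemma scaleR_single:
  "r *\<^sub>R Poly_Mapping.single m a = Poly_Mapping.single m (r * a :: real)"
  by (rule poly_mapping_eqI) (simp add: lookup_scaleR lookup_single when_def)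

lemma linear_eq_on_singles:
  fixes f g :: "('a \<Rightarrow>\<^sub>0 real) \<Rightarrow> 'c::real_vector"
  assumes "linear f" "linear g"
    and "\<And>m. f (Poly_Mapping.single m 1) = g (Poly_Mapping.single m 1)"
  shows "f p = g p"
proof (induction p rule: single_add_induct)
  case zero
  then show ?case using assms by (simp add: linear_0)
next
  case (single k v)
  have "Poly_Mapping.single k v = v *\<^sub>R Poly_Mapping.single k 1"
    by (simp add: scaleR_single)
  then show ?case using assms by (simp only: linear_scale)
next
  case (add a b)
  then show ?case using assms by (simp add: linear_add)
qed

lemma linear_mult_left:
  fixes p :: "'a::monoid_add \<Rightarrow>\<^sub>0 real"
  shows "linear (\<lambda>q. q * p)"
  by (rule linearI) (simp_all add: distrib_right scaleR_mult_poly_mapping)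

lemma linear_mult_right:
  fixes p :: "'a::monoid_add \<Rightarrow>\<^sub>0 real"
  shows "linear (\<lambda>q. p * q)"
  by (rule linearI) (simp_all add: distrib_left scaleR_mult_poly_mapping)

text \<open>Multiplicativity and the Leibniz rule are equalities of two bilinear maps, so that they
can be verified on pairs of monomials.\<close>

lemma bilinear_eq_on_singles:
  fixes F G :: "('a \<Rightarrow>\<^sub>0 real) \<Rightarrow> ('b \<Rightarrow>\<^sub>0 real) \<Rightarrow> 'c::real_vector"
  assumes "\<And>q. linear (\<lambda>p. F p q)" "\<And>p. linear (F p)"
    and "\<And>q. linear (\<lambda>p. G p q)" "\<And>p. linear (G p)"
    and "\<And>m n. F (Poly_Mapping.single m 1) (Poly_Mapping.single n 1)
      = G (Poly_Mapping.single m 1) (Poly_Mapping.single n 1)"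
  shows "F p q = G p q"
proof -
  have "F (Poly_Mapping.single m 1) q = G (Poly_Mapping.single m 1) q" for m
    by (rule linear_eq_on_singles) (use assms in auto)
  then show ?thesis
    by (rule linear_eq_on_singles[OF assms(1) assms(3)])
qed

definition der :: "gen \<Rightarrow> sym \<Rightarrow> sym" where
  "der g = lin_ext (\<lambda>m. Poly_Mapping.single (m - Poly_Mapping.single g 1)
     (real (Poly_Mapping.lookup m g)))"

lemma dU_eq_der: "dU = der GU"
  by (rule ext) (simp add: dU_def der_def lin_ext_def scaleR_single mult.commute)

lemma linear_der: "linear (der g)"
  unfolding der_def by (rule linear_lin_ext)

lemmas der_linear_simps =
  linear_add[OF linear_der] linear_diff[OF linear_der] linear_scale[OF linear_der]
  linear_0[OF linear_der] linear_neg[OF linear_der]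

lemma der_single:
  "der g (Poly_Mapping.single m 1)
    = Poly_Mapping.single (m - Poly_Mapping.single g 1) (real (Poly_Mapping.lookup m g))"
  by (simp add: der_def lin_ext_single)

text \<open>The subtraction of exponents is truncated; this is the case in which it is an honest one.\<close>

lemma minus_single_add:
  fixes m n :: "'a \<Rightarrow>\<^sub>0 nat"
  assumes "Poly_Mapping.lookup m g \<noteq> 0"
  shows "m - Poly_Mapping.single g 1 + n = m + n - Poly_Mapping.single g 1"
  using assms
  by (intro poly_mapping_eqI) (auto simp: lookup_add lookup_minus lookup_single when_def)

lemma der_mult: "der g (p * q) = der g p * q + p * der g q"
proof (rule bilinear_eq_on_singles[where F = "\<lambda>p q. der g (p * q)"])
  fix m n :: "gen \<Rightarrow>\<^sub>0 nat"
  let ?e = "Poly_Mapping.single g (1::nat)"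
  let ?a = "real (Poly_Mapping.lookup m g)" and ?b = "real (Poly_Mapping.lookup n g)"
  have "Poly_Mapping.single (m - ?e + n) ?a = Poly_Mapping.single (m + n - ?e) ?a"
    by (cases "?a = 0") (auto simp del: One_nat_def simp add: minus_single_add)
  moreover have "Poly_Mapping.single (m + (n - ?e)) ?b = Poly_Mapping.single (m + n - ?e) ?b"
    using minus_single_add[of n g m]
    by (cases "?b = 0") (auto simp del: One_nat_def simp add: add.commute)
  ultimately show "der g (Poly_Mapping.single m 1 * Poly_Mapping.single n 1)
      = der g (Poly_Mapping.single m 1) * Poly_Mapping.single n 1
        + Poly_Mapping.single m 1 * der g (Poly_Mapping.single n 1)"
    using Poly_Mapping.single_add[of "m + n - ?e" ?a ?b]
    by (simp add: mult_single der_single lookup_add)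
qed (auto intro!: linearI simp: der_linear_simps distrib_left distrib_right
      scaleR_mult_poly_mapping scaleR_right_distrib)

lemma der_one: "der g 1 = 0"
  using der_single[of g 0] by simp

lemma sin1_axis: "sin1 (axis g 1) = Poly_Mapping.single (Poly_Mapping.single g 1) 1"
proof -
  have "sin1 (axis g 1) = (\<Sum>h\<in>UNIV. if h = g then Poly_Mapping.single (Poly_Mapping.single g 1) 1 else 0)"
    unfolding sin1_def by (rule sum.cong) (auto simp: axis_def)
  then show ?thesis by simp
qed

lemma linear_sin1: "linear sin1"
  by (rule linearI)
    (simp_all add: sin1_def Poly_Mapping.single_add sum.distrib scaleR_sum_right scaleR_single)

lemma der_sin1_axis: "der g (sin1 (axis h 1)) = (if g = h then 1 else 0)"
  by (auto simp: sin1_axis der_single lookup_single when_def simp del: One_nat_def)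

lemma der_commute: "der g (der h p) = der h (der g p)"
proof (rule linear_eq_on_singles[where f = "\<lambda>p. der g (der h p)"])
  fix m :: "gen \<Rightarrow>\<^sub>0 nat"
  have "m - Poly_Mapping.single h 1 - Poly_Mapping.single g 1
      = m - Poly_Mapping.single g 1 - Poly_Mapping.single h 1"
    by (rule poly_mapping_eqI) (simp add: lookup_minus)
  then show "der g (der h (Poly_Mapping.single m 1)) = der h (der g (Poly_Mapping.single m 1))"
    by (simp add: der_def lin_ext_single scaleR_single lookup_minus lookup_single when_def
        mult.commute)
qed (auto intro!: linearI simp: der_linear_simps)

lemma linear_funpow:
  fixes T :: "'a::real_vector \<Rightarrow> 'a"
  shows "linear T \<Longrightarrow> linear (T ^^ n)"
  by (induction n) (simp_all only: funpow.simps linear_id linear_compose)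

lemma funpow_vanishes_beyond:
  fixes T :: "'a::real_vector \<Rightarrow> 'a"
  assumes "linear T" "(T ^^ k) p = 0" "k \<le> n"
  shows "(T ^^ n) p = 0"
proof -
  have "(T ^^ n) p = (T ^^ (n - k)) ((T ^^ k) p)"
    using assms(3) by (simp flip: comp_apply[of "T ^^ _"] funpow_add)
  then show ?thesis using assms by (simp add: linear_0[OF linear_funpow])
qed

text \<open>Each application lowers the exponent of the variable, or kills the monomial.\<close>

lemma der_power_vanishes: "\<exists>n. (der g ^^ n) p = 0"
proof (induction p rule: single_add_induct)
  case zero
  show ?case by (rule exI[of _ 0]) simp
next
  case (single m a)
  have "(der g ^^ n) (Poly_Mapping.single m a) = 0" if "Poly_Mapping.lookup m g < n" for n
    using that
  proof (induction n arbitrary: m a)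
    case (Suc n)
    have "(der g ^^ Suc n) (Poly_Mapping.single m a)
        = (der g ^^ n) (Poly_Mapping.single (m - Poly_Mapping.single g 1)
            (a * real (Poly_Mapping.lookup m g)))"
      by (simp only: funpow_Suc_right comp_apply der_def lin_ext_single scaleR_single)
    also have "\<dots> = 0"
    proof (cases "Poly_Mapping.lookup m g = 0")
      case True
      then show ?thesis by (simp add: linear_0[OF linear_funpow[OF linear_der]])
    next
      case False
      then show ?thesis using Suc by (intro Suc.IH) (simp add: lookup_minus lookup_single)
    qed
    finally show ?case .
  qed simp
  then show ?case by blast
next
  case (add a b)
  then obtain i j where "(der g ^^ i) a = 0" "(der g ^^ j) b = 0" by blast
  then have "(der g ^^ max i j) a = 0" "(der g ^^ max i j) b = 0"
    using funpow_vanishes_beyond[OF linear_der, where k = i and p = a]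
      funpow_vanishes_beyond[OF linear_der, where k = j and p = b] by auto
  then have "(der g ^^ max i j) (a + b) = 0"
    by (simp add: linear_add[OF linear_funpow[OF linear_der]])
  then show ?case by blast
qed

section \<open>Symmetrization\<close>

lemma linear_uin: "linear uin"
proof -
  have tin: "linear tin"
    by (rule linearI)
      (simp_all add: tin_def Poly_Mapping.single_add sum.distrib scaleR_sum_right scaleR_single)
  show ?thesis
    by (rule linearI; transfer)
      (simp_all add: linear_add[OF tin] linear_scale[OF tin] uea_ideal_zero)
qed

lemma uin_commutator: "uin x * uin y - uin y * uin x = uin (lbr x y)"
proof (transfer)
  fix x y
  have "tin x * tin y - tin y * tin x - tin (lbr x y)
      = 1 * (tin x * tin y - tin y * tin x - tin (lbr x y)) * 1" by simp
  then show "tin x * tin y - tin y * tin x - tin (lbr x y) \<in> uea_ideal"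
    unfolding uea_ideal_def by (intro span_base) blast
qed

definition uprod :: "lie list \<Rightarrow> uea" where
  "uprod xs = prod_list (map uin xs)"

lemma uprod_simps [simp]:
  "uprod [] = 1" "uprod (x # xs) = uin x * uprod xs" "uprod (xs @ ys) = uprod xs * uprod ys"
  by (simp_all add: uprod_def)

text \<open>Symmetrized product of arbitrary Lie algebra elements. Unlike the symmetrization of a word in
the basis, it can be compared by multilinearity with a product in the symmetric algebra.\<close>

definition symm_list :: "lie list \<Rightarrow> uea" where
  "symm_list xs = (1 / fact (length xs)) *\<^sub>R
     (\<Sum>\<pi> | \<pi> permutes {..<length xs}. uprod (permute_list \<pi> xs))"

lemma symm_word_eq_symm_list: "symm_word w = symm_list (map (\<lambda>g. axis g 1) w)"
proof -
  have "map (\<lambda>i. uin (axis (w ! \<pi> i) 1)) [0..<length w]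
      = map uin (permute_list \<pi> (map (\<lambda>g. axis g 1) w))"
    if "\<pi> permutes {..<length w}" for \<pi>
    using permutes_in_image[OF that] by (auto simp: permute_list_def)
  then show ?thesis
    unfolding symm_word_def symm_list_def uprod_def
    by (auto intro!: sum.cong arg_cong[where f = "scaleR _"])
qed

lemma symm_list_permute:
  assumes "mset xs = mset ys"
  shows "symm_list xs = symm_list ys"
proof -
  from mset_eq_permutation[OF assms] obtain \<sigma>
    where \<sigma>: "\<sigma> permutes {..<length ys}" "permute_list \<sigma> ys = xs" .
  have "(\<Sum>\<pi> | \<pi> permutes {..<length ys}. uprod (permute_list \<pi> xs))
      = (\<Sum>\<pi> | \<pi> permutes {..<length ys}. uprod (permute_list (\<sigma> \<circ> \<pi>) ys))"
    using \<sigma> by (auto intro!: sum.cong simp: permute_list_compose)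
  also have "\<dots> = (\<Sum>\<pi> | \<pi> permutes {..<length ys}. uprod (permute_list \<pi> ys))"
  proof (rule sum.reindex_bij_witness[where i = "\<lambda>\<pi>. inv \<sigma> \<circ> \<pi>" and j = "\<lambda>\<pi>. \<sigma> \<circ> \<pi>"])
    fix \<pi> assume "\<pi> \<in> {\<pi>. \<pi> permutes {..<length ys}}"
    then have \<pi>: "\<pi> permutes {..<length ys}" by simp
    show "inv \<sigma> \<circ> (\<sigma> \<circ> \<pi>) = \<pi>" "\<sigma> \<circ> (inv \<sigma> \<circ> \<pi>) = \<pi>"
      using permutes_inverses[OF \<sigma>(1)] by (simp_all add: fun_eq_iff)
    show "\<sigma> \<circ> \<pi> \<in> {\<pi>. \<pi> permutes {..<length ys}}" "inv \<sigma> \<circ> \<pi> \<in> {\<pi>. \<pi> permutes {..<length ys}}"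
      using permutes_compose[OF \<pi> \<sigma>(1)] permutes_compose[OF \<pi> permutes_inv[OF \<sigma>(1)]] by simp_all
  qed simp
  finally show ?thesis
    using \<sigma> by (auto simp: symm_list_def mset_eq_length[OF assms])
qed

lemma symm_list_replicate: "symm_list (replicate n w) = uin w ^ n"
proof -
  have "permute_list \<pi> (replicate n w) = replicate n w" if "\<pi> permutes {..<n}" for \<pi>
    using permutes_in_image[OF that]
    by (intro nth_equalityI) (auto simp: permute_list_def)
  moreover have "uprod (replicate n w) = uin w ^ n"
    by (induction n) auto
  ultimately have "(\<Sum>\<pi> | \<pi> permutes {..<n}. uprod (permute_list \<pi> (replicate n w)))
      = (\<Sum>\<pi> | \<pi> permutes {..<n}. uin w ^ n)"
    by (intro sum.cong) auto
  also have "\<dots> = fact n *\<^sub>R uin w ^ n"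
    by (simp add: sum_constant_scaleR card_permutations[of _ n] del: sum_constant)
  finally show ?thesis
    by (simp add: symm_list_def)
qed

lemma linear_sum_maps:
  "(\<And>i. i \<in> A \<Longrightarrow> linear (f i)) \<Longrightarrow> linear (\<lambda>x. \<Sum>i\<in>A. f i x)"
  by (rule linearI) (simp_all add: linear_add linear_scale sum.distrib scaleR_sum_right)

text \<open>In each permuted word the letter \<open>x\<close> stands at exactly one place, so each summand is linear
in \<open>x\<close>.\<close>

lemma linear_symm_list: "linear (\<lambda>x. symm_list (xs @ x # ys))"
proof -
  let ?n = "Suc (length xs + length ys)"
  have lin: "linear (\<lambda>x. uprod (permute_list \<pi> (xs @ x # ys)))" if \<pi>: "\<pi> permutes {..<?n}" for \<pi>
  proof -
    \<comment> \<open>The position at which the letter \<open>x\<close> ends up.\<close>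
    define k where "k = inv \<pi> (length xs)"
    have k: "\<pi> k = length xs" unfolding k_def using permutes_inverses[OF \<pi>] by simp
    have k_less: "k < ?n" using permutes_in_image[OF \<pi>, of k] k by simp
    have split: "[0..<?n] = [0..<k] @ k # [Suc k..<?n]"
    proof -
      have "[0..<?n] = [0..<k] @ [k..<?n]"
        using upt_add_eq_append[of 0 k "?n - k"] k_less by (simp only: le0 le_add_diff_inverse less_imp_le_nat add_0)
      then show ?thesis using upt_conv_Cons[OF k_less] by (simp only:)
    qed
    have nth: "(xs @ x # ys) ! \<pi> i = (xs @ 0 # ys) ! \<pi> i" if "i \<noteq> k" for i x
    proof -
      have "\<pi> i \<noteq> length xs" using that k permutes_inj[OF \<pi>] by (metis injD)
      then show ?thesis by (simp add: nth_append nth_Cons')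
    qed
    define A where "A = map (\<lambda>i. (xs @ 0 # ys) ! \<pi> i) [0..<k]"
    define B where "B = map (\<lambda>i. (xs @ 0 # ys) ! \<pi> i) [Suc k..<?n]"
    have "permute_list \<pi> (xs @ x # ys) = A @ x # B" for x
    proof -
      have "permute_list \<pi> (xs @ x # ys) = map (\<lambda>i. (xs @ x # ys) ! \<pi> i) [0..<?n]"
        by (simp add: permute_list_def del: upt_Suc)
      also have "\<dots> = map (\<lambda>i. (xs @ x # ys) ! \<pi> i) [0..<k] @ x
          # map (\<lambda>i. (xs @ x # ys) ! \<pi> i) [Suc k..<?n]"
        unfolding split by (simp add: k del: upt_Suc)
      also have "\<dots> = A @ x # B"
        unfolding A_def B_def
        by (intro arg_cong2[where f = append] arg_cong2[where f = Cons] map_cong refl nth) auto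
      finally show ?thesis .
    qed
    then have "uprod (permute_list \<pi> (xs @ x # ys)) = uprod A * (uin x * uprod B)" for x
      by simp
    then show ?thesis
      by (intro linearI)
        (simp_all only: linear_add[OF linear_uin] linear_scale[OF linear_uin] distrib_left
          distrib_right mult_scaleR_left mult_scaleR_right)
  qed
  from lin have "linear (\<lambda>x. \<Sum>\<pi> | \<pi> permutes {..<?n}. uprod (permute_list \<pi> (xs @ x # ys)))"
    by (intro linear_sum_maps) auto
  from linear_compose[OF this linear_scale_self, of "1 / fact ?n"] show ?thesis
    by (simp add: symm_list_def comp_def del: fact_Suc)
qed

lemma lie_basis_expansion: "(x :: lie) = (\<Sum>g\<in>UNIV. x $ g *\<^sub>R axis g 1)"
  by (simp add: basis_expansion flip: scalar_mult_eq_scaleR)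

text \<open>The letters are expanded in the basis one after another, from left to right: the induction
keeps a prefix of basis letters.\<close>

lemma multilinear_eq_on_axes:
  fixes F G :: "lie list \<Rightarrow> 'c::real_vector"
  assumes "\<And>as bs. linear (\<lambda>x. F (as @ x # bs))" "\<And>as bs. linear (\<lambda>x. G (as @ x # bs))"
    and "\<And>w. F (map (\<lambda>g. axis g 1) w) = G (map (\<lambda>g. axis g 1) w)"
  shows "F xs = G xs"
proof -
  have "F (map (\<lambda>g. axis g 1) w @ xs) = G (map (\<lambda>g. axis g 1) w @ xs)" for w
  proof (induction xs arbitrary: w)
    case Nil
    then show ?case using assms(3) by simp
  next
    case (Cons x xs)
    have "F (map (\<lambda>g. axis g 1) w @ axis g 1 # xs) = G (map (\<lambda>g. axis g 1) w @ axis g 1 # xs)" for g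
      using Cons.IH[of "w @ [g]"] by simp
    then show ?case
      by (subst (1 2) lie_basis_expansion[of x])
        (simp only: linear_sum[OF assms(1)] linear_sum[OF assms(2)] linear_scale[OF assms(1)]
          linear_scale[OF assms(2)])
  qed
  from this[of "[]"] show ?thesis by simp
qed

lemma symmetrization_eq_lin_ext: "symmetrization = lin_ext (\<lambda>m. symm_word (mon_letters m))"
  by (rule ext) (simp add: symmetrization_def lin_ext_def)

lemma linear_symmetrization: "linear symmetrization"
  unfolding symmetrization_eq_lin_ext by (rule linear_lin_ext)

lemma prod_sin1_axes:
  "prod_list (map (\<lambda>g. sin1 (axis g 1)) w)
    = Poly_Mapping.single (\<Sum>g\<leftarrow>w. Poly_Mapping.single g 1) 1"
  by (induction w) (simp_all add: sin1_axis mult_single)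

lemma mset_mon_letters: "mset (mon_letters (\<Sum>g\<leftarrow>w. Poly_Mapping.single g 1)) = mset w"
proof (rule multiset_eqI)
  fix h
  have "Poly_Mapping.lookup (\<Sum>g\<leftarrow>w. Poly_Mapping.single g (1::nat)) h = count (mset w) h"
    by (induction w) (auto simp: lookup_add lookup_single when_def simp del: One_nat_def)
  then show "count (mset (mon_letters (\<Sum>g\<leftarrow>w. Poly_Mapping.single g 1))) h = count (mset w) h"
    by (cases h) (simp_all add: mon_letters_def)
qed

text \<open>Symmetrization is defined through the sorted word of each monomial. Both sides being multilinear
in the letters, it suffices to compare them on basis words, where the claim is that a symmetrized
product does not depend on the order of its factors.\<close>

theorem symmetrization_prod: "symmetrization (prod_list (map sin1 xs)) = symm_list xs"
proof (rule multilinear_eq_on_axes[where F = "\<lambda>xs. symmetrization (prod_list (map sin1 xs))"])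
  show "linear (\<lambda>x. symmetrization (prod_list (map sin1 (as @ x # bs))))" for as bs
    by (rule linearI)
      (simp_all add: linear_add[OF linear_sin1] linear_scale[OF linear_sin1] distrib_left
        distrib_right scaleR_mult_poly_mapping linear_add[OF linear_symmetrization]
        linear_scale[OF linear_symmetrization])
  show "symmetrization (prod_list (map sin1 (map (\<lambda>g. axis g 1) w)))
      = symm_list (map (\<lambda>g. axis g 1) w)" for w
  proof -
    have "symmetrization (prod_list (map sin1 (map (\<lambda>g. axis g 1) w)))
        = symm_word (mon_letters (\<Sum>g\<leftarrow>w. Poly_Mapping.single g 1))"
      by (simp add: prod_sin1_axes comp_def symmetrization_eq_lin_ext lin_ext_single
          del: One_nat_def)
    also have "\<dots> = symm_list (map (\<lambda>g. axis g 1) w)"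
      unfolding symm_word_eq_symm_list
      by (rule symm_list_permute) (simp add: mset_mon_letters del: One_nat_def)
    finally show ?thesis .
  qed
qed (rule linear_symm_list)

lemma symmetrization_power: "symmetrization (sin1 w ^ n) = uin w ^ n"
  using symmetrization_prod[of "replicate n w"]
  by (simp add: symm_list_replicate prod_list_replicate)

section \<open>Polarization\<close>

text \<open>If all values of a polynomial with vector coefficients lie in a subspace, so do its
coefficients: the combination \<open>P(2t) - 2\<^sup>n\<^sup>+\<^sup>1P(t)\<close> removes the leading term and
multiplies each other coefficient by a nonzero number.\<close>

lemma lin_poly_coeffs_in_subspace:
  fixes a :: "nat \<Rightarrow> 'a::real_vector"
  assumes "subspace S" and "\<And>t::real. (\<Sum>k\<le>n. t ^ k *\<^sub>R a k) \<in> S" and "k \<le> n"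
  shows "a k \<in> S"
  using assms(2,3)
proof (induction n arbitrary: a k)
  case 0
  then show ?case using "0.prems"(1)[of 1] by simp
next
  case (Suc n)
  have low: "a j \<in> S" if "j \<le> n" for j
  proof -
    have "(\<Sum>k\<le>n. t ^ k *\<^sub>R ((2 ^ k - 2 ^ Suc n) *\<^sub>R a k)) \<in> S" for t :: real
    proof -
      have "(\<Sum>k\<le>n. t ^ k *\<^sub>R ((2 ^ k - 2 ^ Suc n) *\<^sub>R a k))
          = (\<Sum>k\<le>Suc n. (2 * t) ^ k *\<^sub>R a k) - 2 ^ Suc n *\<^sub>R (\<Sum>k\<le>Suc n. t ^ k *\<^sub>R a k)"
        by (simp add: scaleR_sum_right scaleR_left_diff_distrib scaleR_right_diff_distrib
            power_mult_distrib sum_subtractf algebra_simps)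
      then show ?thesis
        using Suc.prems(1)[of "2 * t"] Suc.prems(1)[of t] assms(1)
        by (auto intro: subspace_diff subspace_scale)
    qed
    from Suc.IH[OF this that] have "(2 ^ j - 2 ^ Suc n) *\<^sub>R a j \<in> S" .
    moreover have "(2::real) ^ j - 2 ^ Suc n \<noteq> 0"
      using that by (simp add: power_inject_exp[of "2::real" j "Suc n"] del: power_Suc)
    ultimately show ?thesis
      using subspace_scale[OF assms(1), of "(2 ^ j - 2 ^ Suc n) *\<^sub>R a j" "inverse (2 ^ j - 2 ^ Suc n)"]
      by (simp del: power_Suc)
  qed
  \<comment> \<open>The leading coefficient is the value at \<open>1\<close> minus the other coefficients.\<close>
  have "(\<Sum>k\<le>Suc n. a k) \<in> S" "(\<Sum>k\<le>n. a k) \<in> S"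
    using Suc.prems(1)[of 1] low assms(1) by (simp, auto intro: subspace_sum)
  from subspace_diff[OF assms(1) this] have "a (Suc n) \<in> S" by simp
  then show ?case using low Suc.prems(2) by (cases "k = Suc n") auto
qed

lemma scaleR_power_sym: "(r *\<^sub>R p) ^ n = r ^ n *\<^sub>R (p ^ n :: sym)"
  by (induction n) (simp_all add: scaleR_mult_poly_mapping)

lemma of_nat_times_sym: "of_nat k * p = real k *\<^sub>R (p :: sym)"
  by (induction k) (simp_all add: distrib_right scaleR_left_distrib)

lemma numeral_times_sym:
  "numeral n * P = numeral n *\<^sub>R (P :: sym)" "P * numeral n = numeral n *\<^sub>R (P :: sym)"
  using of_nat_times_sym[of "numeral n" P] by (simp_all add: mult.commute)

text \<open>The product \<open>x w\<^sup>n\<close> is, up to the factor \<open>n + 1\<close>, the coefficient of \<open>t\<close> in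
\<open>(tx + w)\<^sup>n\<^sup>+\<^sup>1\<close>.\<close>

lemma sin1_times_power_in_span:
  assumes "subspace p" "x \<in> p" "w \<in> p"
  shows "sin1 x * sin1 w ^ n \<in> span {sin1 w ^ Suc n | w. w \<in> p}" (is "_ \<in> ?S")
proof -
  define a where "a k = real (Suc n choose k) *\<^sub>R (sin1 x ^ k * sin1 w ^ (Suc n - k))" for k
  have "(\<Sum>k\<le>Suc n. t ^ k *\<^sub>R a k) \<in> ?S" for t
  proof -
    have "sin1 (t *\<^sub>R x + w) ^ Suc n = (\<Sum>k\<le>Suc n. t ^ k *\<^sub>R a k)"
      unfolding linear_add[OF linear_sin1] linear_scale[OF linear_sin1] binomial_ring a_def
      by (intro sum.cong refl)
        (simp add: scaleR_power_sym scaleR_mult_poly_mapping of_nat_times_sym mult.assoc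
          mult.commute[of "real _"] del: power_Suc binomial_Suc_Suc)
    moreover have "t *\<^sub>R x + w \<in> p" using assms by (simp add: subspace_add subspace_scale)
    then have "sin1 (t *\<^sub>R x + w) ^ Suc n \<in> ?S" by (intro span_base) blast
    ultimately show ?thesis by (simp only:)
  qed
  from lin_poly_coeffs_in_subspace[OF subspace_span this, of 1]
  have "a 1 \<in> ?S" by simp
  from span_scale[OF this, of "1 / real (Suc n)"] show ?thesis
    by (simp add: a_def del: of_nat_Suc)
qed

text \<open>Linear identities on the symmetric algebra of \<open>p\<close> need only be checked on powers, whose
symmetrizations are again powers.\<close>

lemma Sym_spanned_by_powers:
  assumes "subspace p"
  shows "Sym p \<subseteq> span {sin1 w ^ n | w n. w \<in> p}"
proof -
  have "prod_list (map sin1 xs) \<in> span {sin1 w ^ length xs | w. w \<in> p}" if "set xs \<subseteq> p" for xs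
    using that
  proof (induction xs)
    case Nil
    have "0 \<in> p" using assms by (rule subspace_0)
    then show ?case by (auto intro!: span_base)
  next
    case (Cons x xs)
    then have "prod_list (map sin1 xs) \<in> span {sin1 w ^ length xs | w. w \<in> p}" by simp
    then have "sin1 x * prod_list (map sin1 xs) \<in> span {sin1 w ^ length (x # xs) | w. w \<in> p}"
    proof (induction rule: span_induct_alt)
      case base
      then show ?case by (simp add: span_zero)
    next
      case (step c y z)
      then have "sin1 x * y \<in> span {sin1 w ^ length (x # xs) | w. w \<in> p}"
        using Cons.prems sin1_times_power_in_span[OF assms, of x _ "length xs"] by auto
      with step show ?case
        by (simp add: distrib_left scaleR_mult_poly_mapping span_add span_scale)
    qed
    then show ?case by simp
  qed
  moreover have "span {sin1 w ^ k | w. w \<in> p} \<subseteq> span {sin1 w ^ n | w n. w \<in> p}" for k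
    by (rule span_mono) blast
  ultimately show ?thesis
    unfolding Sym_def by (intro span_minimal subspace_span) blast
qed

section \<open>Surjectivity of symmetrization modulo the left ideal\<close>

lemma subspace_hlam_ideal: "subspace hlam_ideal"
  unfolding hlam_ideal_def by (rule subspace_span)

lemma hlam_ideal_generator: "H \<in> hh \<Longrightarrow> a * (uin H - lam H *\<^sub>R 1) \<in> hlam_ideal"
  unfolding hlam_ideal_def by (intro span_base) blast

lemma hlam_ideal_left_mult: "a \<in> hlam_ideal \<Longrightarrow> c * a \<in> hlam_ideal"
  unfolding hlam_ideal_def
proof (induction rule: span_induct_alt)
  case base
  then show ?case by (simp add: span_zero)
next
  case (step r x y)
  then obtain b H where "x = b * (uin H - lam H *\<^sub>R 1)" "H \<in> hh" by blast
  then have "c * x \<in> span {a * (uin H - lam H *\<^sub>R 1) | a H. H \<in> hh}"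
    using hlam_ideal_generator[of H "c * b"] by (simp add: hlam_ideal_def mult.assoc)
  with step show ?case by (simp add: distrib_left span_add span_scale)
qed

lemma cls_eq_iff: "cls u = cls v \<longleftrightarrow> u - v \<in> hlam_ideal"
proof
  assume "cls u = cls v"
  moreover have "u \<in> cls u" by (simp add: cls_def subspace_0[OF subspace_hlam_ideal])
  ultimately show "u - v \<in> hlam_ideal" by (simp add: cls_def)
next
  assume "u - v \<in> hlam_ideal"
  then have "w - v \<in> hlam_ideal \<longleftrightarrow> w - u \<in> hlam_ideal" for w
    using subspace_add[OF subspace_hlam_ideal, of "w - u" "u - v"]
      subspace_diff[OF subspace_hlam_ideal, of "w - v" "u - v"] by auto
  then show "cls u = cls v" by (auto simp: cls_def)
qed

lemma uea_spanned_by_words: "u \<in> span (range uprod)"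
proof -
  have word: "abs_uea (Poly_Mapping.single (FM w) 1) = uprod (map (\<lambda>g. axis g 1) w)" for w
  proof (induction w)
    case Nil
    show ?case
      by (simp add: one_uea.abs_eq flip: zero_fmon_def)
  next
    case (Cons g w)
    have "tin (axis g 1) = (\<Sum>h\<in>UNIV. if h = g then Poly_Mapping.single (FM [g]) 1 else 0)"
      unfolding tin_def by (rule sum.cong) (auto simp: axis_def)
    then have *: "Poly_Mapping.single (FM (g # w)) 1 = tin (axis g 1) * Poly_Mapping.single (FM w) 1"
      by (simp add: mult_single plus_fmon_def)
    have "uprod (map (\<lambda>g. axis g 1) (g # w))
        = abs_uea (tin (axis g 1)) * abs_uea (Poly_Mapping.single (FM w) 1)"
      using Cons by (simp add: uin.abs_eq)
    also have "\<dots> = abs_uea (Poly_Mapping.single (FM (g # w)) 1)"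
      by (simp only: times_uea.abs_eq *)
    finally show ?case by (rule sym)
  qed
  have "abs_uea t \<in> span (range uprod)" for t
  proof (induction t rule: single_add_induct)
    case zero
    then show ?case by (simp add: span_zero flip: zero_uea.abs_eq)
  next
    case (single k v)
    have "Poly_Mapping.single k v = v *\<^sub>R Poly_Mapping.single (FM (letters k)) 1"
      by (simp add: scaleR_single)
    then have "abs_uea (Poly_Mapping.single k v)
        = v *\<^sub>R uprod (map (\<lambda>g. axis g 1) (letters k))"
      by (simp only: word flip: scaleR_uea.abs_eq)
    then show ?case by (simp add: span_scale span_base)
  next
    case (add a b)
    then show ?case by (simp add: span_add flip: plus_uea.abs_eq)
  qed
  then show ?thesis by (metis Quotient_abs_rep[OF Quotient_uea])
qed

text \<open>The standard filtration of the enveloping algebra, shifted by one so that the words shorter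
than a given one span a step of it.\<close>

definition short_words :: "nat \<Rightarrow> uea set" where
  "short_words n = span {uprod xs | xs. length xs < n}"

lemma subspace_short_words: "subspace (short_words n)"
  unfolding short_words_def by (rule subspace_span)

lemma uprod_in_short_words: "length xs < n \<Longrightarrow> uprod xs \<in> short_words n"
  unfolding short_words_def by (intro span_base) blast

lemma uin_times_short_words:
  "a \<in> short_words n \<Longrightarrow> uin x * a \<in> short_words (Suc n)"
  unfolding short_words_def
proof (induction rule: span_induct_alt)
  case base
  then show ?case by (simp add: span_zero)
next
  case (step c y z)
  then obtain xs where "y = uprod xs" "length xs < n" by blast
  then have "uin x * y \<in> span {uprod xs | xs. length xs < Suc n}"
    using uprod_in_short_words[of "x # xs" "Suc n"] by (simp add: short_words_def)
  with step show ?case by (simp add: distrib_left span_add span_scale)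
qed

text \<open>Each transposition of neighbours costs a bracket, which is a word one letter shorter.\<close>

lemma uprod_move_to_front:
  "uprod (as @ x # bs) - uprod (x # as @ bs) \<in> short_words (Suc (length as + length bs))"
proof (induction as)
  case Nil
  then show ?case by (simp add: subspace_0[OF subspace_short_words])
next
  case (Cons a as)
  have "uprod ((a # as) @ x # bs) - uprod (x # (a # as) @ bs)
      = uin a * (uprod (as @ x # bs) - uprod (x # as @ bs)) + uprod (lbr a x # as @ bs)"
    by (simp add: algebra_simps flip: uin_commutator)
  then show ?case
    using uin_times_short_words[OF Cons, of a] uprod_in_short_words[of "lbr a x # as @ bs"]
    by (auto intro!: subspace_add[OF subspace_short_words])
qed

lemma uprod_permute_mod_short_words:
  assumes "mset xs = mset ys"
  shows "uprod xs - uprod ys \<in> short_words (length xs)"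
  using assms
proof (induction xs arbitrary: ys)
  case Nil
  then show ?case by (simp add: subspace_0[OF subspace_short_words])
next
  case (Cons x xs)
  from Cons.prems have "x \<in> set ys" by (metis list.set_intros(1) set_mset_mset)
  then obtain as bs where ys: "ys = as @ x # bs" by (meson split_list)
  then have m: "mset xs = mset (as @ bs)" using Cons.prems by simp
  then have len: "length xs = length as + length bs" by (metis length_append size_mset)
  have "uprod (x # xs) - uprod ys
      = uin x * (uprod xs - uprod (as @ bs)) - (uprod (as @ x # bs) - uprod (x # as @ bs))"
    by (simp add: ys algebra_simps)
  then show ?case
    using uin_times_short_words[OF Cons.IH[OF m], of x] uprod_move_to_front[of as x bs] len
    by (simp add: subspace_diff[OF subspace_short_words])
qed

text \<open>In the graded algebra of the filtration all orderings of a word agree, hence so does their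
average.\<close>

lemma symm_list_mod_short_words: "symm_list xs - uprod xs \<in> short_words (length xs)"
proof -
  let ?P = "{\<pi>. \<pi> permutes {..<length xs}}"
  have "card ?P = fact (length xs)" by (simp add: card_permutations)
  then have "symm_list xs - uprod xs
      = (1 / fact (length xs)) *\<^sub>R (\<Sum>\<pi>\<in>?P. uprod (permute_list \<pi> xs) - uprod xs)"
    by (simp add: symm_list_def sum_subtractf sum_constant_scaleR scaleR_right_diff_distrib
        del: sum_constant)
  moreover have "uprod (permute_list \<pi> xs) - uprod xs \<in> short_words (length xs)" if "\<pi> \<in> ?P" for \<pi>
    using that uprod_permute_mod_short_words[of "permute_list \<pi> xs" xs] by simp
  ultimately show ?thesis
    by (auto intro!: subspace_scale[OF subspace_short_words] subspace_sum[OF subspace_short_words])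
qed

lemma subspace_Sym: "subspace (Sym p)"
  unfolding Sym_def by (rule subspace_span)

text \<open>The spanning half of the Poincare-Birkhoff-Witt theorem. Up to shorter words the letters of a
word commute; a letter from \<open>\<h>\<close> can thus be moved to the right end, where it acts as a scalar
and shortens the word, while a word in \<open>p\<close> equals its symmetrization.\<close>

theorem beta_surjective:
  assumes complement: "\<And>x. \<exists>y\<in>p. x - y \<in> hh"
  shows "\<exists>P\<in>Sym p. beta P = cls u"
proof -
  define S where "S = {u. \<exists>P\<in>Sym p. symmetrization P - u \<in> hlam_ideal}"
  have S_sub: "subspace S"
  proof (rule subspaceI)
    show "0 \<in> S"
      unfolding S_def using subspace_0[OF subspace_Sym, of p]
      by (auto simp: linear_0[OF linear_symmetrization] subspace_0[OF subspace_hlam_ideal]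
          intro!: bexI[of _ 0])
  next
    fix u v assume "u \<in> S" "v \<in> S"
    then obtain P Q where "P \<in> Sym p" "symmetrization P - u \<in> hlam_ideal"
      "Q \<in> Sym p" "symmetrization Q - v \<in> hlam_ideal" by (auto simp: S_def)
    then show "u + v \<in> S"
      unfolding S_def
      using subspace_add[OF subspace_hlam_ideal, of "symmetrization P - u" "symmetrization Q - v"]
      by (auto intro!: bexI[of _ "P + Q"] subspace_add[OF subspace_Sym]
          simp: linear_add[OF linear_symmetrization] algebra_simps)
  next
    fix c u assume "u \<in> S"
    then obtain P where "P \<in> Sym p" "symmetrization P - u \<in> hlam_ideal" by (auto simp: S_def)
    then show "c *\<^sub>R u \<in> S"
      unfolding S_def
      using subspace_scale[OF subspace_hlam_ideal, of "symmetrization P - u" c]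
      by (auto intro!: bexI[of _ "c *\<^sub>R P"] subspace_scale[OF subspace_Sym]
          simp: linear_scale[OF linear_symmetrization] algebra_simps)
  qed
  have J_S: "hlam_ideal \<subseteq> S"
  proof
    fix u assume "u \<in> hlam_ideal"
    then show "u \<in> S"
      unfolding S_def using subspace_0[OF subspace_Sym, of p]
      by (auto simp: linear_0[OF linear_symmetrization] subspace_neg[OF subspace_hlam_ideal]
          intro!: bexI[of _ 0])
  qed
  have S_trans: "v \<in> S" if "u \<in> S" "u - v \<in> S" for u v
    using subspace_diff[OF S_sub that] by simp
  have "uprod xs \<in> S" for xs
  proof (induction "length xs" arbitrary: xs rule: less_induct)
    case less
    then have short: "short_words (length xs) \<subseteq> S"
      unfolding short_words_def by (intro span_minimal S_sub) auto
    \<comment> \<open>The letters of \<open>zs\<close> remain to be replaced by letters from \<open>p\<close>.\<close>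
    have "uprod (ys @ zs) \<in> S" if "set ys \<subseteq> p" "length (ys @ zs) = length xs" for ys zs
      using that
    proof (induction zs arbitrary: ys)
      case Nil
      have "prod_list (map sin1 ys) \<in> Sym p"
        unfolding Sym_def using Nil by (intro span_base) auto
      then have "symm_list ys \<in> S"
        unfolding S_def
        by (auto simp: symmetrization_prod subspace_0[OF subspace_hlam_ideal]
            intro!: bexI[of _ "prod_list (map sin1 ys)"])
      moreover have "symm_list ys - uprod ys \<in> S"
        using symm_list_mod_short_words[of ys] short Nil by auto
      ultimately show ?case by (simp add: S_trans[of "symm_list ys"])
    next
      case (Cons z zs)
      obtain y where y: "y \<in> p" and h: "z - y \<in> hh" using complement by blast
      have "uprod ((ys @ [y]) @ zs) \<in> S"
        by (rule Cons.IH) (use y Cons.prems in auto)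
      moreover have "uprod (ys @ (z - y) # zs) \<in> S"
      proof -
        let ?h = "z - y"
        have "uprod (ys @ zs) * (uin ?h - lam ?h *\<^sub>R 1) \<in> S"
          using hlam_ideal_generator[OF h] J_S by blast
        moreover have "lam ?h *\<^sub>R uprod (ys @ zs) \<in> S"
          using uprod_in_short_words[of "ys @ zs"] short Cons.prems
          by (intro subspace_scale[OF S_sub]) auto
        ultimately have "uprod (ys @ zs) * (uin ?h - lam ?h *\<^sub>R 1) + lam ?h *\<^sub>R uprod (ys @ zs) \<in> S"
          by (rule subspace_add[OF S_sub])
        then have "uprod (ys @ zs @ [?h]) \<in> S"
          by (simp add: algebra_simps)
        moreover have "uprod (ys @ zs @ [?h]) - uprod (ys @ ?h # zs) \<in> S"
          using uprod_permute_mod_short_words[of "ys @ zs @ [?h]" "ys @ ?h # zs"] short Cons.prems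
          by auto
        ultimately show ?thesis by (rule S_trans)
      qed
      ultimately have "uprod ((ys @ [y]) @ zs) + uprod (ys @ (z - y) # zs) \<in> S"
        by (rule subspace_add[OF S_sub])
      then show ?case
        by (simp add: linear_diff[OF linear_uin] algebra_simps)
    qed
    from this[of "[]" xs] show ?case by simp
  qed
  then have "span (range uprod) \<subseteq> S"
    by (intro span_minimal S_sub) auto
  then have "u \<in> S" using uea_spanned_by_words by blast
  then show ?thesis by (auto simp: S_def beta_def cls_eq_iff)
qed

section \<open>Weyl operators on symbols\<close>

abbreviation uu :: sym where "uu \<equiv> sin1 eU"
abbreviation vv :: sym where "vv \<equiv> sin1 eV"
abbreviation zz :: sym where "zz \<equiv> sin1 eZ"
abbreviation dV :: "sym \<Rightarrow> sym" where "dV \<equiv> der GV"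

lemma linear_dU: "linear dU"
  unfolding dU_eq_der by (rule linear_der)

lemmas dU_linear_simps =
  linear_add[OF linear_dU] linear_diff[OF linear_dU] linear_scale[OF linear_dU]
  linear_0[OF linear_dU] linear_neg[OF linear_dU]

lemma dU_mult: "dU (p * q) = dU p * q + p * dU q"
  by (simp add: dU_eq_der der_mult)

lemma dU_generators [simp]: "dU uu = 1" "dU vv = 0" "dU zz = 0" "dU 1 = 0"
  and dV_generators [simp]: "dV uu = 0" "dV vv = 1" "dV zz = 0" "dV 1 = 0"
  by (simp_all add: dU_eq_der der_sin1_axis der_one)

lemma dV_dU: "dV (dU p) = dU (dV p)"
  unfolding dU_eq_der by (rule der_commute)

lemmas weyl_simps = dU_mult der_mult dU_linear_simps der_linear_simps dV_dU
  scaleR_mult_poly_mapping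

text \<open>The action of \<open>X\<close>. As \<open>X\<close> annihilates the class of \<open>1\<close>, left multiplication by it is the
derivation that extends \<open>ad X\<close>.\<close>

definition adX :: "sym \<Rightarrow> sym" where
  "adX P = vv * dU P + zz * dV P"

text \<open>Left multiplication on the quotient in symmetrized coordinates. The terms \<open>\<partial>\<^sub>v/2\<close> and
\<open>-\<partial>\<^sub>u/2\<close> are half the brackets of \<open>U\<close> and \<open>V\<close> with the other letters of a symmetrized
product; \<open>E\<close> acts as \<open>1\<close>.\<close>

definition weyl :: "lie \<Rightarrow> sym \<Rightarrow> sym" where
  "weyl x P = x $ GX *\<^sub>R adX P + x $ GU *\<^sub>R (uu * P + (1/2) *\<^sub>R dV P)
     + x $ GV *\<^sub>R (vv * P - (1/2) *\<^sub>R dU P) + x $ GZ *\<^sub>R (zz * P) + x $ GE *\<^sub>R P"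

lemma linear_adX: "linear adX"
  by (rule linearI) (simp_all add: adX_def weyl_simps algebra_simps)

lemma linear_weyl: "linear (weyl x)"
  by (rule linearI) (simp_all add: weyl_def adX_def weyl_simps algebra_simps)

lemma linear_weyl_left: "linear (\<lambda>x. weyl x P)"
  by (rule linearI) (simp_all add: weyl_def algebra_simps)

lemma lbr_components:
  "lbr x y $ GX = 0" "lbr x y $ GU = 0"
  "lbr x y $ GV = x $ GX * y $ GU - x $ GU * y $ GX"
  "lbr x y $ GE = x $ GU * y $ GV - x $ GV * y $ GU"
  "lbr x y $ GZ = x $ GX * y $ GV - x $ GV * y $ GX"
  by (simp_all add: lbr_def axis_def)

lemma weyl_commutator: "weyl x (weyl y P) - weyl y (weyl x P) = weyl (lbr x y) P"
proof (rule poly_mapping_eqI)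
  fix k
  show "Poly_Mapping.lookup (weyl x (weyl y P) - weyl y (weyl x P)) k
      = Poly_Mapping.lookup (weyl (lbr x y) P) k"
    unfolding weyl_def adX_def lbr_components weyl_simps
    by (simp add: weyl_simps distrib_left distrib_right right_diff_distrib left_diff_distrib
      scaleR_right_distrib scaleR_left_distrib mult.left_commute mult.assoc lookup_add lookup_minus lookup_scaleR)
     (simp add: field_simps)
qed

definition act :: "tens \<Rightarrow> sym \<Rightarrow> sym" where
  "act t P = lin_ext (\<lambda>w. foldr (\<lambda>g. weyl (axis g 1)) (letters w) P) t"

lemma linear_act_left: "linear (\<lambda>t. act t P)"
  unfolding act_def by (rule linear_lin_ext)

lemma linear_act: "linear (act t)"
proof -
  have "linear (\<lambda>P. foldr (\<lambda>g. weyl (axis g 1)) w P)" for w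
  proof (induction w)
    case Nil
    show ?case by (simp add: linear_ident)
  next
    case (Cons g w)
    from linear_compose[OF this linear_weyl[of "axis g 1"]] show ?case by (simp add: comp_def)
  qed
  then show ?thesis
    unfolding act_def lin_ext_def
    by (intro linear_sum_maps linear_compose_scale_right)
qed

lemma act_mult: "act (s * t) P = act s (act t P)"
proof (rule bilinear_eq_on_singles[where F = "\<lambda>s t. act (s * t) P"])
  show "linear (\<lambda>s. act (s * t) P)" "linear (\<lambda>t. act (s * t) P)" for s t
    using linear_compose[OF linear_mult_left linear_act_left]
      linear_compose[OF linear_mult_right linear_act_left] by (simp_all add: comp_def)
  show "linear (\<lambda>s. act s (act t P))" "linear (\<lambda>t. act s (act t P))" for s t
    using linear_act_left linear_compose[OF linear_act_left linear_act] by (simp_all add: comp_def)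
qed (simp add: act_def mult_single lin_ext_single plus_fmon_def)

lemma act_one: "act 1 P = P"
proof -
  have "letters (0 :: gen fmon) = []" by (simp add: zero_fmon_def)
  then show ?thesis
    using lin_ext_single[of "\<lambda>w. foldr (\<lambda>g. weyl (axis g 1)) (letters w) P" 0 1]
    by (simp add: act_def)
qed

lemma act_tin: "act (tin x) P = weyl x P"
proof -
  have "act (tin x) P = (\<Sum>g\<in>UNIV. x $ g *\<^sub>R weyl (axis g 1) P)"
    unfolding tin_def linear_sum[OF linear_act_left]
    by (simp add: act_def lin_ext_single)
  also have "\<dots> = weyl (\<Sum>g\<in>UNIV. x $ g *\<^sub>R axis g 1) P"
    by (simp add: linear_sum[OF linear_weyl_left] linear_scale[OF linear_weyl_left])
  finally show ?thesis by (simp flip: lie_basis_expansion)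
qed

lemma act_uea_ideal: "t \<in> uea_ideal \<Longrightarrow> act t P = 0"
  unfolding uea_ideal_def
proof (induction rule: span_induct_alt)
  case base
  show ?case by (rule linear_0[OF linear_act_left])
next
  case (step c s t)
  then obtain a b x y where "s = a * (tin x * tin y - tin y * tin x - tin (lbr x y)) * b" by blast
  then have "act s P = act a (weyl x (weyl y (act b P)) - weyl y (weyl x (act b P)) - weyl (lbr x y) (act b P))"
    by (simp add: act_mult act_tin linear_diff[OF linear_act_left])
  then have "act s P = 0" by (simp add: weyl_commutator linear_0[OF linear_act])
  with step show ?case by (simp add: linear_add[OF linear_act_left] linear_scale[OF linear_act_left])
qed

lift_definition rho :: "uea \<Rightarrow> sym \<Rightarrow> sym" is act
proof (rule ext)
  fix s t P assume "s - t \<in> uea_ideal"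
  then show "act s P = act t P"
    using act_uea_ideal[of "s - t" P] by (simp add: linear_diff[OF linear_act_left])
qed

lemma linear_rho_left: "linear (\<lambda>a. rho a P)"
  by (rule linearI; transfer)
    (simp_all add: linear_add[OF linear_act_left] linear_scale[OF linear_act_left])

lemma linear_rho: "linear (rho a)"
  by (rule linearI; transfer) (simp_all add: linear_add[OF linear_act] linear_scale[OF linear_act])

lemma rho_mult: "rho (a * b) P = rho a (rho b P)"
  by transfer (rule act_mult)

lemma rho_one: "rho 1 P = P"
  by transfer (rule act_one)

lemma rho_uin: "rho (uin x) P = weyl x P"
  by transfer (rule act_tin)

lemma rho_power: "rho (uin x ^ n) P = (weyl x ^^ n) P"
  by (induction n arbitrary: P) (simp_all add: rho_one rho_mult rho_uin)

lemma hh_components: "H \<in> hh \<Longrightarrow> H $ GU = 0 \<and> H $ GV = 0 \<and> H $ GZ = 0"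
  unfolding hh_def by (induction rule: span_induct_alt) (auto simp: axis_def)

lemma rho_hlam_ideal: "a \<in> hlam_ideal \<Longrightarrow> rho a 1 = 0"
  unfolding hlam_ideal_def
proof (induction rule: span_induct_alt)
  case base
  show ?case by (rule linear_0[OF linear_rho_left])
next
  case (step c s t)
  then obtain a H where s: "s = a * (uin H - lam H *\<^sub>R 1)" and "H \<in> hh" by blast
  then have "weyl H 1 = lam H *\<^sub>R 1"
    by (simp add: weyl_def adX_def hh_components lam_def)
  then have "rho s 1 = 0"
    by (simp add: s rho_mult linear_diff[OF linear_rho_left] linear_scale[OF linear_rho_left] rho_uin
        rho_one linear_0[OF linear_rho])
  with step show ?case by (simp add: linear_add[OF linear_rho_left] linear_scale[OF linear_rho_left])
qed

lemma rho_cls_cong: "cls a = cls b \<Longrightarrow> rho a 1 = rho b 1"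
  using rho_hlam_ideal[of "a - b"] by (simp add: cls_eq_iff linear_diff[OF linear_rho_left])

text \<open>Since \<open>aX\<close> lies in the left ideal, so does \<open>Xa\<close>.\<close>

lemma hinv_in_kernel_adX:
  assumes "a \<in> hinv"
  shows "adX (rho a 1) = 0"
proof -
  have X: "eX \<in> hh" unfolding hh_def by (rule span_base) simp
  have "rho (uin eX * a - a * uin eX) 1 = 0"
    using assms X rho_hlam_ideal by (auto simp: hinv_def)
  then show ?thesis
    by (simp add: linear_diff[OF linear_rho_left] rho_mult rho_uin weyl_def axis_def
        linear_0[OF linear_rho] linear_0[OF linear_adX]) (simp add: adX_def linear_0[OF linear_rho])
qed

text \<open>The left ideal is not a right ideal, but moving the generators past an element that commutes
with them modulo the ideal does no harm. This makes the product of invariants well defined.\<close>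

lemma hlam_ideal_right_mult:
  assumes "a \<in> hlam_ideal" "b \<in> hinv"
  shows "a * b \<in> hlam_ideal"
  using assms(1) unfolding hlam_ideal_def
proof (induction rule: span_induct_alt)
  case base
  show ?case by (simp add: span_zero)
next
  case (step c s t)
  then obtain a H where s: "s = a * (uin H - lam H *\<^sub>R 1)" and H: "H \<in> hh" by blast
  have "s * b = (a * b) * (uin H - lam H *\<^sub>R 1) + a * (uin H * b - b * uin H)"
    by (simp add: s algebra_simps)
  moreover have "a * (uin H * b - b * uin H) \<in> hlam_ideal"
    using assms(2) H by (intro hlam_ideal_left_mult) (simp add: hinv_def)
  ultimately have "s * b \<in> hlam_ideal"
    using hlam_ideal_generator[OF H, of "a * b"] by (simp add: subspace_add[OF subspace_hlam_ideal])
  with step show ?case by (simp add: distrib_right span_add span_scale hlam_ideal_def)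
qed

lemma hinv_closed:
  shows "1 \<in> hinv" and "a \<in> hinv \<Longrightarrow> b \<in> hinv \<Longrightarrow> a + b \<in> hinv"
    and "a \<in> hinv \<Longrightarrow> r *\<^sub>R a \<in> hinv" and "a \<in> hinv \<Longrightarrow> b \<in> hinv \<Longrightarrow> a * b \<in> hinv"
proof -
  show "1 \<in> hinv" by (simp add: hinv_def subspace_0[OF subspace_hlam_ideal])
  show "a + b \<in> hinv" if "a \<in> hinv" "b \<in> hinv"
    unfolding hinv_def
  proof safe
    fix H assume "H \<in> hh"
    then have "(uin H * a - a * uin H) + (uin H * b - b * uin H) \<in> hlam_ideal"
      using that by (intro subspace_add[OF subspace_hlam_ideal]) (auto simp: hinv_def)
    then show "uin H * (a + b) - (a + b) * uin H \<in> hlam_ideal"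
      by (simp add: algebra_simps)
  qed
  show "r *\<^sub>R a \<in> hinv" if "a \<in> hinv"
    using that subspace_scale[OF subspace_hlam_ideal, of _ r]
    by (auto simp: hinv_def simp flip: scaleR_diff_right)
  show "a * b \<in> hinv" if "a \<in> hinv" "b \<in> hinv"
    unfolding hinv_def
  proof safe
    fix H assume H: "H \<in> hh"
    then have "(uin H * a - a * uin H) * b + a * (uin H * b - b * uin H) \<in> hlam_ideal"
      using that
      by (intro subspace_add[OF subspace_hlam_ideal] hlam_ideal_right_mult hlam_ideal_left_mult)
        (auto simp: hinv_def)
    then show "uin H * (a * b) - a * b * uin H \<in> hlam_ideal"
      by (simp add: algebra_simps)
  qed
qed

section \<open>Exponentials of locally nilpotent operators\<close>

definition locally_nilpotent :: "('a::real_vector \<Rightarrow> 'a) \<Rightarrow> bool" where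
  "locally_nilpotent T \<longleftrightarrow> linear T \<and> (\<forall>P. \<exists>n. (T ^^ n) P = 0)"

lemma exp_op_eq_sum:
  assumes "linear T" "(T ^^ N) P = 0"
  shows "exp_op T P = (\<Sum>n<N. (1 / fact n) *\<^sub>R (T ^^ n) P)"
proof -
  have "(T ^^ n) P = 0" if "N \<le> n" for n
    using funpow_vanishes_beyond[OF assms that] .
  then have "{n. (1 / fact n) *\<^sub>R (T ^^ n) P \<noteq> 0} \<subseteq> {..<N}"
    by (auto simp: not_le[symmetric])
  then show ?thesis
    unfolding exp_op_def by (intro Sum_any.expand_superset) auto
qed

lemma linear_exp_op:
  assumes "locally_nilpotent T"
  shows "linear (exp_op T)"
proof (rule linearI)
  have lin: "linear T" and nil: "\<exists>n. (T ^^ n) P = 0" for P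
    using assms by (auto simp: locally_nilpotent_def)
  fix P Q :: sym and r :: real
  obtain i j where "(T ^^ i) P = 0" "(T ^^ j) Q = 0" using nil by blast
  then have PQ: "(T ^^ max i j) P = 0" "(T ^^ max i j) Q = 0"
    using funpow_vanishes_beyond[OF lin] by (meson max.cobounded1 max.cobounded2)+
  then show "exp_op T (P + Q) = exp_op T P + exp_op T Q"
    by (simp add: exp_op_eq_sum[OF lin, of "max i j"] linear_add[OF linear_funpow[OF lin]]
        scaleR_right_distrib sum.distrib)
  from PQ(1) show "exp_op T (r *\<^sub>R P) = r *\<^sub>R exp_op T P"
    by (simp add: exp_op_eq_sum[OF lin, of "max i j"] linear_scale[OF linear_funpow[OF lin]]
        scaleR_sum_right mult.commute)
qed

lemma exp_op_fixes_kernel: "linear T \<Longrightarrow> T P = 0 \<Longrightarrow> exp_op T P = P"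
  using exp_op_eq_sum[of T 1 P] by simp

text \<open>Conjugation by an exponential: if \<open>g = [T,f]\<close>, \<open>h = [T,g]\<close> and \<open>[T,h] = 0\<close>, then
\<open>exp(T) f exp(-T) = f + [T,f] + [T,[T,f]]/2\<close>. Two commutators suffice below: up to
derivatives, a commutator with the exponent of \<open>Theta\<close> turns \<open>u\<close> into \<open>v\<close> or \<open>z\<close>, and \<open>v\<close> into
\<open>z\<close>, which is central.\<close>

lemma exp_op_intertwines:
  assumes T: "locally_nilpotent T" and lin: "linear f" "linear g" "linear h"
    and f: "\<And>P. T (f P) = f (T P) + g P"
    and g: "\<And>P. T (g P) = g (T P) + h P"
    and h: "\<And>P. T (h P) = h (T P)"
  shows "exp_op T (f P) = f (exp_op T P) + g (exp_op T P) + (1/2) *\<^sub>R h (exp_op T P)"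
proof -
  have linT: "linear T" using T by (simp add: locally_nilpotent_def)
  obtain N where N: "(T ^^ N) P = 0" using T by (auto simp: locally_nilpotent_def)
  \<comment> \<open>The \<open>n\<close>-th term of the exponential series, delayed by \<open>k\<close> steps and zero before it starts.\<close>
  define e where "e k n = (if n < k then 0 else (1 / fact (n - k)) *\<^sub>R (T ^^ (n - k)) P)" for k n
  have shift: "e (Suc k) (Suc n) = e k n" for k n by (simp add: e_def)
  have Te: "T (e k n) = (real n + 1 - real k) *\<^sub>R e k (Suc n)" for k n
  proof -
    consider "n < k" | m where "n = k + m" by (metis le_add_diff_inverse not_le)
    then show ?thesis
    proof cases
      case 1
      then show ?thesis by (cases "Suc n = k") (auto simp: e_def linear_0[OF linT])
    next
      case 2
      have "real m + 1 \<noteq> 0" by linarith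
      then have "(real m + 1) / fact (Suc m) = 1 / fact m" by (simp add: add.commute)
      with 2 show ?thesis
        by (simp add: e_def linear_scale[OF linT] Suc_diff_le del: fact_Suc)
    qed
  qed
  have term_eq: "(1 / fact n) *\<^sub>R (T ^^ n) (f P) = f (e 0 n) + g (e 1 n) + (1/2) *\<^sub>R h (e 2 n)" for n
  proof (induction n)
    case 0
    then show ?case by (simp add: e_def linear_0 lin)
  next
    case (Suc n)
    have s: "e 0 n = e 1 (Suc n)" "e 1 n = e 2 (Suc n)"
      using shift[of 0 n] shift[of 1 n] by (simp_all add: numeral_2_eq_2)
    have "(1 / fact (Suc n)) *\<^sub>R (T ^^ Suc n) (f P)
        = (1 / (real n + 1)) *\<^sub>R T ((1 / fact n) *\<^sub>R (T ^^ n) (f P))"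
      by (simp add: linear_scale[OF linT] add.commute)
    also have "T ((1 / fact n) *\<^sub>R (T ^^ n) (f P))
        = f (T (e 0 n)) + g (e 0 n) + (g (T (e 1 n)) + h (e 1 n)) + (1/2) *\<^sub>R h (T (e 2 n))"
      by (simp add: Suc f g h linear_add[OF linT] linear_scale[OF linT])
    also have "\<dots> = (real n + 1) *\<^sub>R (f (e 0 (Suc n)) + g (e 1 (Suc n)) + (1/2) *\<^sub>R h (e 2 (Suc n)))"
      unfolding Te unfolding s
      by (simp add: linear_scale lin linear_add linear_diff numeral_times_sym scaleR_right_distrib scaleR_left_distrib
          scaleR_left_diff_distrib diff_divide_distrib add_divide_distrib)
    finally show ?case by simp
  qed
  have sum_e: "(\<Sum>n<N + 2. e k n) = exp_op T P" if "k \<le> 2" for k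
  proof -
    have "(\<Sum>n<N + 2. e k n) = (\<Sum>n\<in>{k..<N + 2}. e k n)"
      by (rule sum.mono_neutral_right) (auto simp: e_def)
    also have "\<dots> = (\<Sum>n<N + 2 - k. (1 / fact n) *\<^sub>R (T ^^ n) P)"
      by (rule sum.reindex_bij_witness[where i = "\<lambda>n. n + k" and j = "\<lambda>n. n - k"])
        (auto simp: e_def)
    also have "\<dots> = exp_op T P"
      using that by (intro exp_op_eq_sum[symmetric] linT funpow_vanishes_beyond[OF linT N]) simp
    finally show ?thesis .
  qed
  have "(T ^^ (N + 2)) (f P) = 0"
  proof -
    have "e 0 (N + 2) = 0" "e 1 (N + 2) = 0" "e 2 (N + 2) = 0"
      using N by (simp_all add: e_def linear_0[OF linT])
    then show ?thesis using term_eq[of "N + 2"] by (simp add: linear_0 lin del: fact_Suc)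
  qed
  then have "exp_op T (f P) = (\<Sum>n<N + 2. f (e 0 n) + g (e 1 n) + (1/2) *\<^sub>R h (e 2 n))"
    by (simp only: exp_op_eq_sum[OF linT] term_eq)
  also have "\<dots> = f (\<Sum>n<N + 2. e 0 n) + g (\<Sum>n<N + 2. e 1 n) + (1/2) *\<^sub>R h (\<Sum>n<N + 2. e 2 n)"
    by (simp only: sum.distrib scaleR_sum_right linear_sum[OF lin(1)] linear_sum[OF lin(2)]
        linear_sum[OF lin(3)])
  also have "\<dots> = f (exp_op T P) + g (exp_op T P) + (1/2) *\<^sub>R h (exp_op T P)"
    by (simp only: sum_e order_refl one_le_numeral zero_le)
  finally show ?thesis .
qed

text \<open>If a factor \<open>\<partial>\<^sub>u\<close> can be split off and commutes with the rest, then the \<open>n\<close>-th power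
contains \<open>\<partial>\<^sub>u\<^sup>n\<close>, which kills each polynomial for large \<open>n\<close>.\<close>

lemma locally_nilpotent_through_dU:
  assumes "linear S" "\<And>P. dU (S P) = S (dU P)"
  shows "locally_nilpotent (\<lambda>P. S (dU P))"
proof -
  have comm: "dU ((S ^^ n) P) = (S ^^ n) (dU P)" for n P
    by (induction n) (simp_all add: assms(2))
  have "((\<lambda>P. S (dU P)) ^^ n) P = (S ^^ n) ((dU ^^ n) P)" for n P
    by (induction n) (simp_all add: comm)
  moreover have "\<exists>n. (dU ^^ n) P = 0" for P
    unfolding dU_eq_der by (rule der_power_vanishes)
  ultimately have "\<exists>n. ((\<lambda>P. S (dU P)) ^^ n) P = 0" for P
    by (metis linear_0[OF linear_funpow[OF assms(1)]])
  moreover have "linear (\<lambda>P. S (dU P))"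
    using linear_compose[OF linear_dU assms(1)] by (simp add: comp_def)
  ultimately show ?thesis by (simp add: locally_nilpotent_def)
qed

section \<open>The intertwiner between the two polarizations\<close>

lemma ct_coeff_constant [simp]: "dU (ct_coeff c) = 0" "dV (ct_coeff c) = 0"
  by (simp_all add: ct_coeff_def weyl_simps)

text \<open>The cubic term alone would do on invariants. The second term compensates for the occurrence of
\<open>X\<close> in \<open>qql l\<close>; with it the exponential relates the two symmetrizations on all classes, which
makes a proof by generators possible.\<close>

definition log_Theta :: "real \<Rightarrow> sym \<Rightarrow> sym" where
  "log_Theta c P = ct_coeff c * dU (dU (dU P)) + (1 / (2 * c)) *\<^sub>R adX (dU P)"

definition Theta :: "real \<Rightarrow> sym \<Rightarrow> sym" where
  "Theta c = exp_op (log_Theta c)"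

lemma dU_adX: "dU (adX P) = adX (dU P)"
  by (simp add: adX_def weyl_simps)

lemma locally_nilpotent_log_Theta: "locally_nilpotent (log_Theta c)"
proof -
  let ?S = "\<lambda>P. ct_coeff c * dU (dU P) + (1 / (2 * c)) *\<^sub>R adX P"
  have "linear ?S"
    by (rule linearI) (simp_all add: weyl_simps linear_add[OF linear_adX] linear_scale[OF linear_adX]
        algebra_simps)
  moreover have "dU (?S P) = ?S (dU P)" for P
    by (simp add: weyl_simps dU_adX)
  ultimately have "locally_nilpotent (\<lambda>P. ?S (dU P))"
    by (rule locally_nilpotent_through_dU)
  then show ?thesis by (simp add: log_Theta_def[abs_def])
qed

lemma linear_Theta: "linear (Theta c)"
  unfolding Theta_def by (rule linear_exp_op[OF locally_nilpotent_log_Theta])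

lemma Theta_one: "Theta c 1 = 1"
  unfolding Theta_def using locally_nilpotent_log_Theta[of c]
  by (intro exp_op_fixes_kernel)
    (simp_all add: locally_nilpotent_def log_Theta_def dU_linear_simps linear_0[OF linear_adX])

text \<open>After conjugation by \<open>Theta\<close> an element \<open>w\<close> of \<open>qql l\<close> acts as multiplication by its
symbol plus \<open>z - c\<close> times half a derivation. The two hypotheses on coordinates say
that \<open>w\<close> is a combination of \<open>Z\<close>, \<open>V\<close> and \<open>X - cU\<close>. The coefficient of \<open>\<partial>\<^sub>u\<^sup>3\<close> in \<open>log_Theta c\<close> is
the one for which all terms in \<open>\<partial>\<^sub>u\<^sup>2\<close> cancel.\<close>

lemma Theta_weyl:
  assumes c: "c \<noteq> 0" and w: "w $ GE = 0" "w $ GU = - c * w $ GX"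
  shows "Theta c (weyl w P)
    = (w $ GU *\<^sub>R uu + w $ GV *\<^sub>R vv + w $ GZ *\<^sub>R zz) * Theta c P
      + (zz - c *\<^sub>R 1) * ((w $ GV / (2 * c)) *\<^sub>R dU (Theta c P) - (w $ GU / (2 * c)) *\<^sub>R dV (Theta c P))"
proof -
  let ?A = "w $ GU" and ?B = "w $ GV"
  \<comment> \<open>The first and the second commutator of \<open>log_Theta c\<close> with \<open>weyl w\<close>.\<close>
  define g where "g P = ?A *\<^sub>R (3 *\<^sub>R (ct_coeff c * dU (dU P)) + (1 / (2 * c)) *\<^sub>R (adX P + vv * dU P)
      - (1 / (4 * c)) *\<^sub>R dU (dU P)) + (?B / (2 * c)) *\<^sub>R (zz * dU P)" for P
  define h where "h P = (?A / (4 * c^2)) *\<^sub>R (zz * dU (dU P))" for P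
  have x: "w $ GX = - ?A / c" using c w by simp
  note expand = weyl_simps adX_def distrib_left distrib_right right_diff_distrib left_diff_distrib
    scaleR_right_distrib scaleR_left_distrib mult.left_commute mult.assoc
    lookup_add lookup_minus lookup_scaleR numeral_times_sym
  have "exp_op (log_Theta c) (weyl w P) = weyl w (exp_op (log_Theta c) P) + g (exp_op (log_Theta c) P)
      + (1/2) *\<^sub>R h (exp_op (log_Theta c) P)"
  proof (rule exp_op_intertwines[OF locally_nilpotent_log_Theta linear_weyl])
    show "linear g" "linear h"
      by (rule linearI; simp add: g_def h_def weyl_simps linear_add[OF linear_adX]
          linear_scale[OF linear_adX] algebra_simps)+
    show "log_Theta c (weyl w P) = weyl w (log_Theta c P) + g P" for P
      by (rule poly_mapping_eqI)
       (use c in \<open>simp add: log_Theta_def weyl_def g_def expand ct_coeff_def w(1); simp add: field_simps\<close>)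
    show "log_Theta c (g P) = g (log_Theta c P) + h P" for P
      by (rule poly_mapping_eqI)
       (use c in \<open>simp add: log_Theta_def weyl_def g_def h_def expand ct_coeff_def w(1); simp add: field_simps power2_eq_square\<close>)
    show "log_Theta c (h P) = h (log_Theta c P)" for P
      by (rule poly_mapping_eqI)
       (use c in \<open>simp add: log_Theta_def h_def expand ct_coeff_def; simp add: field_simps\<close>)
  qed
  also have "\<dots> = (w $ GU *\<^sub>R uu + w $ GV *\<^sub>R vv + w $ GZ *\<^sub>R zz) * exp_op (log_Theta c) P
      + (zz - c *\<^sub>R 1) * ((w $ GV / (2 * c)) *\<^sub>R dU (exp_op (log_Theta c) P)
        - (w $ GU / (2 * c)) *\<^sub>R dV (exp_op (log_Theta c) P))"
    by (rule poly_mapping_eqI)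
     (use c in \<open>simp add: weyl_def g_def h_def expand ct_coeff_def w(1) x; simp add: field_simps power2_eq_square\<close>)
  finally show ?thesis by (simp only: Theta_def)
qed

section \<open>Symbols of the two symmetrizations\<close>

lemma setX0_eq_lin_ext:
  "setX0 = lin_ext (\<lambda>m. if Poly_Mapping.lookup m GX = 0 then Poly_Mapping.single m 1 else 0)"
  by (rule ext)
    (auto simp: setX0_def lin_ext_def scaleR_single sum.inter_filter intro!: sum.cong)

lemma linear_setX0: "linear setX0"
  unfolding setX0_eq_lin_ext by (rule linear_lin_ext)

lemma setX0_mult: "setX0 (P * Q) = setX0 P * setX0 Q"
proof (rule bilinear_eq_on_singles[where F = "\<lambda>P Q. setX0 (P * Q)"])
  show "linear (\<lambda>P. setX0 (P * Q))" "linear (\<lambda>Q. setX0 (P * Q))" for P Q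
    using linear_compose[OF linear_mult_left linear_setX0]
      linear_compose[OF linear_mult_right linear_setX0] by (simp_all add: comp_def)
  show "linear (\<lambda>P. setX0 P * setX0 Q)" "linear (\<lambda>Q. setX0 P * setX0 Q)" for P Q
    using linear_compose[OF linear_setX0 linear_mult_left]
      linear_compose[OF linear_setX0 linear_mult_right] by (simp_all add: comp_def)
qed (simp add: setX0_eq_lin_ext lin_ext_single mult_single lookup_add)

lemma setX0_one: "setX0 1 = 1"
  using lin_ext_single[of "\<lambda>m. if Poly_Mapping.lookup m GX = 0 then Poly_Mapping.single m (1::real) else 0" 0 1]
  by (simp add: setX0_eq_lin_ext)

lemma setX0_power: "setX0 (P ^ n) = setX0 P ^ n"
  by (induction n) (simp_all add: setX0_one setX0_mult)

lemma sin1_expansion: "sin1 w = (\<Sum>g\<in>UNIV. w $ g *\<^sub>R sin1 (axis g 1))"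
  by (subst lie_basis_expansion[of w]) (simp only: linear_sum[OF linear_sin1] linear_scale[OF linear_sin1])

lemma setX0_sin1:
  assumes "w $ GE = 0"
  shows "setX0 (sin1 w) = w $ GU *\<^sub>R uu + w $ GV *\<^sub>R vv + w $ GZ *\<^sub>R zz"
  unfolding sin1_expansion[of w]
  by (simp add: UNIV_gen assms linear_add[OF linear_setX0] linear_scale[OF linear_setX0])
    (simp add: sin1_axis setX0_eq_lin_ext lin_ext_single lookup_single)

lemma eval_at_eq_lin_ext:
  "eval_at l = lin_ext (\<lambda>m. \<Prod>g\<in>UNIV. l (axis g 1) ^ Poly_Mapping.lookup m g)"
  by (rule ext) (simp add: eval_at_def lin_ext_def)

lemma linear_eval_at: "linear (eval_at l)"
  unfolding eval_at_eq_lin_ext by (rule linear_lin_ext)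

lemmas eval_at_linear_simps =
  linear_add[OF linear_eval_at] linear_diff[OF linear_eval_at] linear_scale[OF linear_eval_at]
  linear_0[OF linear_eval_at] linear_neg[OF linear_eval_at]

lemma eval_at_mult: "eval_at l (P * Q) = eval_at l P * eval_at l Q"
proof (rule bilinear_eq_on_singles[where F = "\<lambda>P Q. eval_at l (P * Q)"])
  show "linear (\<lambda>P. eval_at l (P * Q))" "linear (\<lambda>Q. eval_at l (P * Q))" for P Q
    using linear_compose[OF linear_mult_left linear_eval_at]
      linear_compose[OF linear_mult_right linear_eval_at] by (simp_all add: comp_def)
  show "linear (\<lambda>P. eval_at l P * eval_at l Q)" "linear (\<lambda>Q. eval_at l P * eval_at l Q)" for P Q
    by (rule linearI; simp add: eval_at_linear_simps algebra_simps)+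
qed (simp add: eval_at_eq_lin_ext lin_ext_single mult_single lookup_add power_add prod.distrib)

lemma eval_at_one: "eval_at l 1 = 1"
  using lin_ext_single[of "\<lambda>m. \<Prod>g\<in>UNIV. l (axis g 1) ^ Poly_Mapping.lookup m g" 0 1]
  by (simp add: eval_at_eq_lin_ext)

lemma eval_at_power: "eval_at l (P ^ n) = eval_at l P ^ n"
  by (induction n) (simp_all add: eval_at_one eval_at_mult)

lemma eval_at_generator: "eval_at l (sin1 (axis g 1)) = l (axis g 1)"
proof -
  have "eval_at l (sin1 (axis g 1))
      = (\<Prod>h\<in>UNIV. l (axis h 1) ^ Poly_Mapping.lookup (Poly_Mapping.single g 1) h)"
    by (simp add: sin1_axis eval_at_eq_lin_ext lin_ext_single)
  also have "\<dots> = (\<Prod>h\<in>UNIV. if h = g then l (axis h 1) else 1)"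
    by (intro prod.cong refl) (simp add: lookup_single when_def)
  finally show ?thesis by simp
qed

text \<open>The Poisson derivation defined by a linear form annihilates that form, hence its powers.
This is why no correction terms arise in the symbol of a power.\<close>

lemma directional_derivative_kills_power:
  fixes w :: lie
  defines "L \<equiv> w $ GU *\<^sub>R uu + w $ GV *\<^sub>R vv + w $ GZ *\<^sub>R zz"
  shows "w $ GV *\<^sub>R dU (L ^ n) = w $ GU *\<^sub>R dV (L ^ n)"
proof (induction n)
  case (Suc n)
  have "w $ GV *\<^sub>R dU (L ^ Suc n) - w $ GU *\<^sub>R dV (L ^ Suc n)
      = L * (w $ GV *\<^sub>R dU (L ^ n) - w $ GU *\<^sub>R dV (L ^ n))"
    by (simp add: weyl_simps L_def algebra_simps)
  then show ?case using Suc by simp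
qed (simp add: dU_generators)

text \<open>Criterion for \<open>\<Theta>\<close> to compute the inverse of symmetrization on \<open>p\<close>: it must turn the action of
\<open>w \<in> p\<close> on a power of \<open>w\<close> into multiplication by \<open>w\<close>.\<close>

theorem symbol_of_symmetrization:
  assumes "subspace p" and "linear \<Theta>" and "\<Theta> 1 = 1"
    and step: "\<And>w n P. w \<in> p \<Longrightarrow> \<Theta> P = setX0 (sin1 w) ^ n
      \<Longrightarrow> \<Theta> (weyl w P) = setX0 (sin1 w) ^ Suc n"
    and P: "P \<in> Sym p"
  shows "\<Theta> (rho (symmetrization P) 1) = setX0 P"
proof -
  have "P \<in> span {sin1 w ^ n | w n. w \<in> p}"
    using P Sym_spanned_by_powers[OF assms(1)] by blast
  then show ?thesis
  proof (induction rule: span_induct_alt)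
    case base
    then show ?case
      by (simp add: linear_0[OF linear_symmetrization] linear_0[OF linear_rho_left]
          linear_0[OF assms(2)] linear_0[OF linear_setX0])
  next
    case (step c Q R)
    then obtain w n where Q: "Q = sin1 w ^ n" and w: "w \<in> p" by blast
    have "\<Theta> ((weyl w ^^ n) 1) = setX0 (sin1 w) ^ n"
    proof (induction n)
      case (Suc n)
      then show ?case using assms(4)[OF w] by simp
    qed (simp add: assms(3))
    then have "\<Theta> (rho (symmetrization Q) 1) = setX0 Q"
      by (simp add: Q symmetrization_power rho_power setX0_power)
    with step show ?case
      by (simp add: linear_add[OF linear_symmetrization] linear_scale[OF linear_symmetrization]
          linear_add[OF linear_rho_left] linear_scale[OF linear_rho_left]
          linear_add[OF assms(2)] linear_scale[OF assms(2)]
          linear_add[OF linear_setX0] linear_scale[OF linear_setX0])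
  qed
qed

text \<open>The inverse is defined by choosing a preimage. The value does not depend on the choice, as any
preimage has the symbol \<open>\<Theta> (a \<cdot> 1)\<close>.\<close>

lemma beta_inv_eq:
  assumes complement: "\<And>x. \<exists>y\<in>p. x - y \<in> hh"
    and symbol: "\<And>P. P \<in> Sym p \<Longrightarrow> \<Theta> (rho (symmetrization P) 1) = setX0 P"
  shows "beta_inv p (cls a) = \<Theta> (rho a 1)"
proof -
  define P where "P = inv_into (Sym p) beta (cls a)"
  have "cls a \<in> beta ` Sym p" using beta_surjective[OF complement, of a] by (metis image_eqI)
  then have "P \<in> Sym p" "beta P = cls a"
    unfolding P_def by (simp_all only: inv_into_into f_inv_into_f)
  then have "rho (symmetrization P) 1 = rho a 1"
    by (intro rho_cls_cong) (simp add: beta_def)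
  then show ?thesis
    using symbol[OF \<open>P \<in> Sym p\<close>] by (simp add: beta_inv_def P_def)
qed

lemma axis_component: "axis a (1::real) $ b = (if b = a then 1 else 0)"
  by (simp add: axis_def)

lemma in_hh: "(\<And>g. g \<noteq> GX \<Longrightarrow> g \<noteq> GE \<Longrightarrow> h $ g = 0) \<Longrightarrow> h \<in> hh"
proof -
  assume *: "\<And>g. g \<noteq> GX \<Longrightarrow> g \<noteq> GE \<Longrightarrow> h $ g = 0"
  have "h = h $ GX *\<^sub>R eX + h $ GE *\<^sub>R eE"
  proof (rule vec_eq_iff[THEN iffD2], rule allI)
    fix g show "h $ g = (h $ GX *\<^sub>R eX + h $ GE *\<^sub>R eE) $ g"
      using * by (cases g) (auto simp: axis_def)
  qed
  also have "\<dots> \<in> hh"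
    unfolding hh_def by (intro span_add span_scale span_base) auto
  finally show "h \<in> hh" .
qed

text \<open>The Weyl operators are written in the coordinates of this very symmetrization, so the identity
takes the place of \<open>\<Theta>\<close>.\<close>

lemma beta_inv_qq: "beta_inv qq (cls a) = rho a 1"
proof (rule beta_inv_eq[where \<Theta> = "\<lambda>P. P"])
  show "\<exists>y\<in>qq. x - y \<in> hh" for x
  proof
    show "x $ GZ *\<^sub>R eZ + x $ GV *\<^sub>R eV + x $ GU *\<^sub>R eU \<in> qq"
      unfolding qq_def by (intro span_add span_scale span_base) auto
    show "x - (x $ GZ *\<^sub>R eZ + x $ GV *\<^sub>R eV + x $ GU *\<^sub>R eU) \<in> hh"
    proof (rule in_hh)
      fix g assume "g \<noteq> GX" "g \<noteq> GE"
      then show "(x - (x $ GZ *\<^sub>R eZ + x $ GV *\<^sub>R eV + x $ GU *\<^sub>R eU)) $ g = 0"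
        by (cases g) (auto simp: axis_component)
    qed
  qed
  fix P assume "P \<in> Sym qq"
  show "rho (symmetrization P) 1 = setX0 P"
  proof (rule symbol_of_symmetrization[where \<Theta> = "\<lambda>P. P", OF _ linear_ident refl _ \<open>P \<in> Sym qq\<close>])
    show "subspace qq" unfolding qq_def by (rule subspace_span)
    fix w n Q assume w: "w \<in> qq" and Q: "Q = setX0 (sin1 w) ^ n"
    have comp: "w $ GX = 0 \<and> w $ GE = 0"
      using w unfolding qq_def by (induction rule: span_induct_alt) (auto simp: axis_def)
    have "weyl w Q = setX0 (sin1 w) * Q + (1/2) *\<^sub>R (w $ GU *\<^sub>R dV Q - w $ GV *\<^sub>R dU Q)"
      using comp by (simp add: weyl_def setX0_sin1 algebra_simps scaleR_mult_poly_mapping)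
    also have "w $ GU *\<^sub>R dV Q - w $ GV *\<^sub>R dU Q = 0"
      using comp directional_derivative_kills_power[of w n] by (simp add: Q setX0_sin1)
    finally show "weyl w Q = setX0 (sin1 w) ^ Suc n" by (simp add: Q)
  qed
qed

text \<open>The coordinate along \<open>V\<close> is unconstrained, because \<open>V\<close> itself belongs to \<open>qql l\<close>.\<close>

lemma qql_components:
  assumes "w \<in> qql l"
  shows "w $ GE = 0" "w $ GU = - l eZ * w $ GX"
proof -
  have "qql l \<subseteq> {w. w $ GE = 0 \<and> w $ GU = - l eZ * w $ GX}"
    unfolding qql_def
  proof (rule span_minimal)
    show "subspace {w. w $ GE = 0 \<and> w $ GU = - l eZ * w $ GX}"
      by (rule subspaceI) (simp_all add: distrib_left)
  qed (simp add: axis_component)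
  then show "w $ GE = 0" "w $ GU = - l eZ * w $ GX" using assms by auto
qed

lemma symbol_qql:
  assumes "l eZ \<noteq> 0" "P \<in> Sym (qql l)"
  shows "Theta (l eZ) (rho (symmetrization P) 1) = setX0 P"
proof (rule symbol_of_symmetrization[OF _ linear_Theta Theta_one _ assms(2)])
  show "subspace (qql l)" unfolding qql_def by (rule subspace_span)
  let ?c = "l eZ"
  fix w n Q assume w: "w \<in> qql l" and Q: "Theta ?c Q = setX0 (sin1 w) ^ n"
  note comp = qql_components[OF w]
  have "(w $ GV / (2 * ?c)) *\<^sub>R dU (Theta ?c Q) - (w $ GU / (2 * ?c)) *\<^sub>R dV (Theta ?c Q)
      = (1 / (2 * ?c)) *\<^sub>R (w $ GV *\<^sub>R dU (Theta ?c Q) - w $ GU *\<^sub>R dV (Theta ?c Q))"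
    by (simp add: scaleR_right_diff_distrib)
  also have "\<dots> = 0"
    unfolding Q setX0_sin1[OF comp(1)] by (simp add: directional_derivative_kills_power)
  finally show "Theta ?c (weyl w Q) = setX0 (sin1 w) ^ Suc n"
    by (simp add: Theta_weyl[OF assms(1) comp] Q setX0_sin1[OF comp(1)] del: mult_minus_left)
qed

lemma complement_qql:
  assumes "l eZ \<noteq> 0"
  shows "\<exists>y\<in>qql l. x - y \<in> hh"
proof
  \<comment> \<open>The multiple of \<open>Y\<close> that matches the \<open>U\<close>-coordinate of \<open>x\<close>; \<open>V\<close> and \<open>Z\<close> correct the rest.\<close>
  let ?t = "- x $ GU / l eZ" and ?Y = "eX - l eZ *\<^sub>R eU + l eV *\<^sub>R eV"
  show "x $ GZ *\<^sub>R eZ + (x $ GV - ?t * l eV) *\<^sub>R eV + ?t *\<^sub>R ?Y \<in> qql l"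
    unfolding qql_def by (intro span_add[OF span_add] span_scale span_base) auto
  show "x - (x $ GZ *\<^sub>R eZ + (x $ GV - ?t * l eV) *\<^sub>R eV + ?t *\<^sub>R ?Y) \<in> hh"
  proof (rule in_hh)
    fix g assume "g \<noteq> GX" "g \<noteq> GE"
    then show "(x - (x $ GZ *\<^sub>R eZ + (x $ GV - ?t * l eV) *\<^sub>R eV + ?t *\<^sub>R ?Y)) $ g = 0"
      using assms by (cases g) (auto simp: axis_component)
  qed
qed

lemma beta_inv_qql:
  assumes "l eZ \<noteq> 0"
  shows "beta_inv (qql l) (cls a) = Theta (l eZ) (rho a 1)"
  using complement_qql[of l, OF assms] symbol_qql[of l, OF assms] by (rule beta_inv_eq)

text \<open>The derivation commutes with \<open>\<partial>\<^sub>u\<close> and kills the coefficient of the cubic term, so its kernel is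
stable under that term, and the two exponents agree on it.\<close>

lemma Theta_on_kernel_adX:
  assumes "adX P = 0"
  shows "Theta c P = exp_op (cubic_op (ct_coeff c)) P"
proof -
  have "(log_Theta c ^^ n) P = (cubic_op (ct_coeff c) ^^ n) P \<and> adX ((log_Theta c ^^ n) P) = 0" for n
  proof (induction n)
    case (Suc n)
    let ?Q = "(log_Theta c ^^ n) P"
    have e: "(cubic_op (ct_coeff c) ^^ n) P = ?Q" and Q: "adX ?Q = 0" using Suc.IH by metis+
    then have "adX (dU ?Q) = 0" by (simp add: dU_linear_simps flip: dU_adX)
    then have step: "log_Theta c ?Q = cubic_op (ct_coeff c) ?Q" by (simp add: log_Theta_def cubic_op_def)
    have "adX (ct_coeff c * dU (dU (dU ?Q))) = ct_coeff c * dU (dU (dU (adX ?Q)))"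
      by (simp add: adX_def weyl_simps algebra_simps)
    then have "adX (log_Theta c ?Q) = 0" by (simp add: step cubic_op_def Q dU_linear_simps)
    with step show ?case unfolding funpow.simps comp_apply e by simp
  qed (simp add: assms)
  then show ?thesis by (simp add: Theta_def exp_op_def)
qed

section \<open>Evaluation at the functional\<close>

text \<open>A coefficient free of \<open>u\<close> commutes with \<open>\<partial>\<^sub>u\<^sup>3\<close>; the operator with coefficient \<open>1\<close> is
\<open>\<partial>\<^sub>u\<^sup>3\<close> itself.\<close>

lemma cubic_op_power:
  assumes "dU K = 0"
  shows "(cubic_op K ^^ n) P = K ^ n * ((cubic_op 1 ^^ n) P)"
proof -
  have dU_K: "dU (K ^ n) = 0" for n
    by (induction n) (simp_all add: dU_mult assms)
  show ?thesis
    by (induction n) (simp_all add: cubic_op_def dU_mult dU_K mult.assoc mult.left_commute)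
qed

lemma locally_nilpotent_cubic_op:
  assumes "dU K = 0"
  shows "locally_nilpotent (cubic_op K)"
proof -
  have "linear (\<lambda>P. K * dU (dU P))"
    by (rule linearI) (simp_all add: weyl_simps algebra_simps)
  moreover have "dU (K * dU (dU P)) = K * dU (dU (dU P))" for P
    by (simp add: weyl_simps assms)
  ultimately have "locally_nilpotent (\<lambda>P. K * dU (dU (dU P)))"
    by (rule locally_nilpotent_through_dU)
  then show ?thesis by (simp add: cubic_op_def[abs_def])
qed

text \<open>Since \<open>\<partial>\<^sub>u\<^sup>3\<close> commutes with the coefficients and evaluation is multiplicative, only the values
of the coefficients at \<open>l\<close> count, and opposite values give inverse exponentials.\<close>

lemma eval_at_exp_inverse:
  assumes "dU K = 0" "dU M = 0" and "eval_at l M = - eval_at l K"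
  shows "eval_at l (exp_op (cubic_op M) (exp_op (cubic_op K) P)) = eval_at l P"
proof -
  define d where "d = cubic_op 1"
  have lin: "linear (cubic_op K)" "linear (cubic_op M)" "linear d"
    and "\<exists>n. (d ^^ n) P = 0"
    using locally_nilpotent_cubic_op[of K] locally_nilpotent_cubic_op[of M]
      locally_nilpotent_cubic_op[of 1] assms by (auto simp: locally_nilpotent_def d_def)
  then obtain N where "(d ^^ N) P = 0" by blast
  then have N: "(d ^^ n) P = 0" if "N \<le> n" for n
    using funpow_vanishes_beyond[OF lin(3)] that by blast
  have K: "(cubic_op K ^^ n) Q = K ^ n * (d ^^ n) Q" and M: "(cubic_op M ^^ n) Q = M ^ n * (d ^^ n) Q" for n Q
    by (simp_all only: d_def cubic_op_power[OF assms(1)] cubic_op_power[OF assms(2)])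
  define R where "R = exp_op (cubic_op K) P"
  have R: "R = (\<Sum>m<N. (1 / fact m) *\<^sub>R (K ^ m * (d ^^ m) P))"
    unfolding R_def by (subst exp_op_eq_sum[OF lin(1), of N]) (simp_all add: K N)
  have d_mult: "(d ^^ n) (K ^ m * Q) = K ^ m * (d ^^ n) Q" for n m Q
  proof -
    have "dU (K ^ m) = 0" by (induction m) (simp_all add: dU_mult assms)
    then show ?thesis by (induction n) (simp_all add: d_def cubic_op_def dU_mult)
  qed
  have dR: "(d ^^ n) R = (\<Sum>m<N. (1 / fact m) *\<^sub>R (K ^ m * (d ^^ (n + m)) P))" for n
    unfolding R
    by (simp add: linear_sum[OF linear_funpow[OF lin(3)]] linear_scale[OF linear_funpow[OF lin(3)]]
        d_mult funpow_add)
  have "(d ^^ N) R = 0" unfolding dR by (simp add: N)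
  then have "exp_op (cubic_op M) R = (\<Sum>n<N. (1 / fact n) *\<^sub>R (M ^ n * (d ^^ n) R))"
    by (subst exp_op_eq_sum[OF lin(2), of N]) (simp_all add: M)
  define k where "k = eval_at l K"
  define E where "E j = eval_at l ((d ^^ j) P)" for j
  define F where "F n m = (- k) ^ n / fact n * (k ^ m / fact m * E (n + m))" for n m
  have E0: "E j = 0" if "N \<le> j" for j
    using N[OF that] by (simp add: E_def eval_at_linear_simps)
  have E_nz: "j < N" if "E j \<noteq> 0" for j
    using E0[of j] that by (meson not_le)
  \<comment> \<open>Sorting the double sum by \<open>n + m\<close> leaves the binomial expansion of \<open>(k - k)\<^sup>j\<close>.\<close>
  have "eval_at l (exp_op (cubic_op M) R) = (\<Sum>n<N. \<Sum>m<N. F n m)"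
    unfolding \<open>exp_op (cubic_op M) R = _\<close> dR
    by (simp add: linear_sum[OF linear_eval_at] eval_at_linear_simps eval_at_mult eval_at_power
        assms(3) sum_distrib_left F_def E_def flip: k_def)
  also have "\<dots> = (\<Sum>(n, m)\<in>{..<N} \<times> {..<N}. F n m)"
    by (simp add: sum.cartesian_product)
  also have "\<dots> = (\<Sum>(n, m)\<in>{(n, m). n + m < N}. F n m)"
    by (rule sum.mono_neutral_right) (auto simp: F_def dest: E_nz)
  also have "\<dots> = (\<Sum>j<N. \<Sum>n\<le>j. F n (j - n))"
    by (rule sum.triangle_reindex)
  also have "\<dots> = (\<Sum>j<N. if j = 0 then E 0 else 0)"
  proof (rule sum.cong)
    fix j
    have "(\<Sum>n\<le>j. F n (j - n)) = (\<Sum>n\<le>j. real (j choose n) * (- k) ^ n * k ^ (j - n)) * (E j / fact j)"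
      unfolding sum_distrib_right
      by (rule sum.cong) (simp_all add: F_def binomial_fact)
    also have "\<dots> = (- k + k) ^ j * (E j / fact j)"
      by (simp only: binomial_ring)
    finally show "(\<Sum>n\<le>j. F n (j - n)) = (if j = 0 then E 0 else 0)"
      by (simp add: power_0_left)
  qed simp
  also have "\<dots> = E 0"
    using E0[of 0] by (cases "N = 0") auto
  finally show ?thesis by (simp add: E_def R_def)
qed

lemma lam_hperp_values:
  assumes "l \<in> lam_hperp"
  shows "linear l" "l eX = 0"
proof -
  obtain \<xi> where l: "l = (\<lambda>x. lam x + \<xi> x)" and \<xi>: "linear \<xi>" "\<forall>H\<in>hh. \<xi> H = 0"
    using assms by (auto simp: lam_hperp_def hperp_def)
  have "linear lam" by (rule linearI) (simp_all add: lam_def)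
  then show "linear l" unfolding l using \<xi>(1) by (rule linear_compose_add)
  have "eX \<in> hh" unfolding hh_def by (rule span_base) simp
  then show "l eX = 0" using \<xi>(2) by (simp add: l lam_def axis_def)
qed

lemma eval_at_sin1: "linear l \<Longrightarrow> eval_at l (sin1 w) = l w"
  by (subst (2) lie_basis_expansion[of w])
    (simp add: sin1_expansion[of w] linear_sum[OF linear_eval_at] eval_at_linear_simps
      eval_at_generator linear_sum linear_scale)

text \<open>The derivation terms of the conjugated action carry the factor \<open>z - l(Z)\<close>, which vanishes at
\<open>l\<close>.\<close>

lemma eval_at_Theta_weyl:
  assumes "linear l" "l eX = 0" "l eZ \<noteq> 0" "w \<in> qql l"
  shows "eval_at l (Theta (l eZ) (weyl w Q)) = l w * eval_at l (Theta (l eZ) Q)"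
proof -
  note comp = qql_components[OF assms(4)]
  have "l w = w $ GU * l eU + w $ GV * l eV + w $ GZ * l eZ"
    by (subst lie_basis_expansion[of w])
      (simp add: UNIV_gen linear_add[OF assms(1)] linear_scale[OF assms(1)] assms(2) comp(1))
  then show ?thesis
    by (simp add: Theta_weyl[OF assms(3) comp] eval_at_linear_simps eval_at_mult eval_at_generator
        eval_at_one)
qed

text \<open>The eigenvalue property iterated on powers, which span the symmetric algebra.\<close>

lemma eval_at_Theta_symmetrization:
  assumes "linear l" "l eX = 0" "l eZ \<noteq> 0" "P \<in> Sym (qql l)"
  shows "eval_at l (Theta (l eZ) (rho (symmetrization P) Q))
    = eval_at l P * eval_at l (Theta (l eZ) Q)"
proof -
  let ?\<tau> = "\<lambda>Q. eval_at l (Theta (l eZ) Q)"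
  have "subspace (qql l)" unfolding qql_def by (rule subspace_span)
  then have "P \<in> span {sin1 w ^ n | w n. w \<in> qql l}"
    using assms(4) Sym_spanned_by_powers by blast
  then show ?thesis
  proof (induction rule: span_induct_alt)
    case base
    then show ?case
      by (simp add: linear_0[OF linear_symmetrization] linear_0[OF linear_rho_left]
          linear_0[OF linear_Theta] eval_at_linear_simps)
  next
    case (step r R S)
    then obtain w n where R: "R = sin1 w ^ n" and w: "w \<in> qql l" by blast
    have "?\<tau> ((weyl w ^^ n) Q) = l w ^ n * ?\<tau> Q"
      by (induction n) (simp_all add: eval_at_Theta_weyl[OF assms(1-3) w])
    then have "?\<tau> (rho (symmetrization R) Q) = eval_at l R * ?\<tau> Q"
      by (simp add: R symmetrization_power rho_power eval_at_power eval_at_sin1 assms(1))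
    with step show ?case
      by (simp add: linear_add[OF linear_symmetrization] linear_scale[OF linear_symmetrization]
          linear_add[OF linear_rho_left] linear_scale[OF linear_rho_left]
          linear_add[OF linear_Theta] linear_scale[OF linear_Theta] eval_at_linear_simps
          distrib_right)
  qed
qed

text \<open>Modulo the left ideal \<open>a\<close> is a symmetrization over \<open>qql l\<close>, whose elements act through the
functional by scalars. Invariance of \<open>b\<close> is what allows \<open>a\<close> to be replaced inside the product.\<close>

lemma eval_at_Theta_mult:
  assumes "linear l" "l eX = 0" "l eZ \<noteq> 0" "b \<in> hinv"
  shows "eval_at l (Theta (l eZ) (rho (a * b) 1))
    = eval_at l (Theta (l eZ) (rho a 1)) * eval_at l (Theta (l eZ) (rho b 1))"
proof -
  obtain P where P: "P \<in> Sym (qql l)" and "beta P = cls a"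
    using beta_surjective[OF complement_qql[of l], of a] assms(3) by blast
  then have aP: "symmetrization P - a \<in> hlam_ideal" by (simp add: beta_def cls_eq_iff)
  have "rho ((symmetrization P - a) * b) 1 = 0"
    by (intro rho_hlam_ideal hlam_ideal_right_mult aP assms(4))
  then have "rho (a * b) 1 = rho (symmetrization P) (rho b 1)"
    by (simp add: left_diff_distrib linear_diff[OF linear_rho_left] rho_mult)
  moreover have "rho a 1 = rho (symmetrization P) 1"
    using rho_hlam_ideal[OF aP] by (simp add: linear_diff[OF linear_rho_left])
  ultimately show ?thesis
    using eval_at_Theta_symmetrization[OF assms(1-3) P] by (simp add: Theta_one eval_at_one)
qed

theorem theorem3p1:
  fixes l :: "lie \<Rightarrow> real"
  assumes "l \<in> lam_hperp" and "l eZ \<noteq> 0"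
  shows "(\<forall>u\<in>inv_alg.
            beta_inv (qql l) u = exp_op (cubic_op (ct_coeff (l eZ))) (beta_inv qq u))
       \<and> (\<forall>v\<in>inv_alg \<inter> ZA_polynomials.
            eval_at l (beta_inv qq v)
              = eval_at l (exp_op (cubic_op ((- 1 / (24 * l eZ)) *\<^sub>R 1)) (beta_inv (qql l) v)))
       \<and> is_character (gamma_CT l)"
proof -
  note l = lam_hperp_values[OF assms(1)]
  have Theta: "Theta (l eZ) (rho a 1) = exp_op (cubic_op (ct_coeff (l eZ))) (rho a 1)"
    if "a \<in> hinv" for a
    by (rule Theta_on_kernel_adX[OF hinv_in_kernel_adX[OF that]])
  have part1: "beta_inv (qql l) u = exp_op (cubic_op (ct_coeff (l eZ))) (beta_inv qq u)"
    if "u \<in> inv_alg" for u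
    using that Theta by (auto simp: inv_alg_def beta_inv_qq beta_inv_qql[of l, OF assms(2)])
  have "eval_at l (ct_coeff (l eZ)) = 1 / (24 * l eZ)"
    using assms(2)
    by (simp add: ct_coeff_def eval_at_linear_simps eval_at_one eval_at_generator)
  then have part2: "eval_at l (beta_inv qq v)
      = eval_at l (exp_op (cubic_op ((- 1 / (24 * l eZ)) *\<^sub>R 1)) (beta_inv (qql l) v))"
    if "v \<in> inv_alg" for v
    unfolding part1[OF that]
    by (subst eval_at_exp_inverse) (simp_all add: dU_linear_simps eval_at_linear_simps eval_at_one)
  have gamma: "gamma_CT l (cls a) = eval_at l (Theta (l eZ) (rho a 1))" if "a \<in> hinv" for a
    by (simp add: gamma_CT_def beta_inv_qq Theta[OF that])
  have "is_character (gamma_CT l)"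
    unfolding is_character_def
    by (simp add: gamma hinv_closed rho_one Theta_one eval_at_one eval_at_Theta_mult[OF l assms(2)]
        linear_add[OF linear_rho_left] linear_scale[OF linear_rho_left]
        linear_add[OF linear_Theta] linear_scale[OF linear_Theta] eval_at_linear_simps)
  with part1 part2 show ?thesis by blast
qed

end
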